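(* Let $\varepsilon,\delta>0$, $\alpha,\beta\ge 0$, $\psi\ge 0$ and $n,k\in\mathbb{N}$. Let $\mathbb{M}$ be an $(\varepsilon,\delta)$-differentially private mechanism which is $(\alpha,\beta)$-empirically-accurate for $k$ rounds given $n$ samples. If $n\ge \frac{\log(2k\varepsilon/\delta)}{\varepsilon^2}$, then $\mathbb{M}$ is also $\left(\alpha+10\varepsilon+2\psi,\ \beta+\frac{\delta}{\varepsilon}\right)$-statistically-accurate for $k$ rounds with respect to measures with $\psi$-Gibbs dependence; that is, for every probability measure $\mu$ over $\mathcal{X}^n$ with $\psi$-Gibbs dependence and every adversary $\mathbb{A}$, when $S\sim\mu$ and $\mathbb{A}$ interacts with $\mathbb{M}(S)$ for $k$ rounds with queries $q_1,\dots,q_k$ and answers $a_1,\dots,a_k$, $$\Pr\left[\max_{i\in[k]}|q_i(\mu)-a_i|>\alpha+10\varepsilon+2\psi\right]\le\beta+\frac{\delta}{\varepsilon}.$$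
   Context: $\mathcal{X}$ is a (metric) domain. For a probability measure $\mu$ over $\mathcal{X}^n$ let $$\psi(\mu)=\sup_{x\in\mathcal{X}^n}\ \mathbb{E}_{i\sim[n]}\left\|\mu_i(\cdot)-\mu_i(\cdot\mid x^{-i})\right\|_{TV},$$ where $i$ is uniform on $[n]=\{1,\dots,n\}$, $\mu_i$ is the $i$-th marginal, $\mu_i(\cdot\mid x^{-i})$ is the conditional distribution of the $i$-th coordinate given that all other coordinates equal those of $x$, and $\|\cdot\|_{TV}$ is total variation distance. $\mu$ has $\psi$-Gibbs dependence if $\psi(\mu)\le\psi$. Game: a (randomized) mechanism $\mathbb{M}$ receives a dataset $S\in\mathcal{X}^n$. For $i=1,\dots,k$, the adversary $\mathbb{A}$ (which sees only previous answers) picks a query $q_i:\mathcal{X}\to\{0,1\}$, possibly depending on all previous answers, and $\mathbb{M}$ responds with $a_i\in\mathbb{R}$, which is given to $\mathbb{A}$. Write $q(S)=\frac1n\sum_{x\in S}q(x)$ and $q(\mu)=\mathbb{E}_{T\sim\mu}[q(T)]$. $\mathbb{M}$ is $(\alpha,\beta)$-empirically-accurate for $k$ rounds given $n$ samples if for every $S\in\mathcal{X}^n$ and every adversary $\mathbb{A}$, $\Pr[\max_{i\in[k]}|q_i(S)-a_i|>\alpha]\le\beta$. A randomized algorithm $\mathcal{A}$ on $\mathcal{X}^n$ is $(\varepsilon,\delta)$-differentially private if for all datasets $S,S'$ differing in a single entry and all measurable sets $A$ of outputs, $\Pr[\mathcal{A}(S)\in A]\le e^{\varepsilon}\Pr[\mathcal{A}(S')\in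 A]+\delta$. The interactive mechanism $\mathbb{M}$ is $(\varepsilon,\delta)$-differentially private if for every adversary $\mathbb{A}$ the algorithm mapping $S$ to the transcript of the $k$-round interaction is $(\varepsilon,\delta)$-differentially private. *)

theory Defs
  imports "HOL-Probability.Probability"
begin

section \<open>Datasets and Gibbs dependence\<close>

text \<open>Coordinates are numbered \<open>0, \<dots>, n - 1\<close>. A dataset is an element of the product
  \<open>X^n\<close> of the Borel space of the metric space \<open>X\<close>, hence an extensional function.\<close>

abbreviation coords_space :: "nat set \<Rightarrow> (nat \<Rightarrow> 'x::metric_space) measure" where
  "coords_space I \<equiv> PiM I (\<lambda>_. borel)"

abbreviation data_space :: "nat \<Rightarrow> (nat \<Rightarrow> 'x::metric_space) measure" where
  "data_space n \<equiv> coords_space {..<n}"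

definition tv_dist :: "'a measure \<Rightarrow> 'a measure \<Rightarrow> real" where
  "tv_dist P Q = (SUP A\<in>sets P. \<bar>measure P A - measure Q A\<bar>)"

definition marginal :: "(nat \<Rightarrow> 'x::metric_space) measure \<Rightarrow> nat \<Rightarrow> 'x measure" where
  "marginal \<mu> i = distr \<mu> borel (\<lambda>x. x i)"

definition others :: "nat \<Rightarrow> nat \<Rightarrow> (nat \<Rightarrow> 'x) \<Rightarrow> nat \<Rightarrow> 'x" where
  "others n i x = restrict x ({..<n} - {i})"

text \<open>\<open>\<kappa>\<close> is a (regular) version of the conditional distribution of the \<open>i\<close>-th coordinate
  given all the others: \<open>\<kappa> (others n i x)\<close> plays the role of \<open>\<mu>\<^sub>i(\<cdot> | x\<^sup>-\<^sup>i)\<close>.\<close>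

definition conditional_version ::
  "nat \<Rightarrow> (nat \<Rightarrow> 'x::metric_space) measure \<Rightarrow> nat \<Rightarrow> ((nat \<Rightarrow> 'x) \<Rightarrow> 'x measure) \<Rightarrow> bool" where
  "conditional_version n \<mu> i \<kappa> \<longleftrightarrow>
     \<kappa> \<in> coords_space ({..<n} - {i}) \<rightarrow>\<^sub>M prob_algebra borel \<and>
     (\<forall>A\<in>sets borel. \<forall>B\<in>sets (coords_space ({..<n} - {i})).
        measure \<mu> {x \<in> space \<mu>. x i \<in> A \<and> others n i x \<in> B} =
        (\<integral>x. indicator B (others n i x) * measure (\<kappa> (others n i x)) A \<partial>\<mu>))"

text \<open>All the total variation distances below are at most 1, so the supremum is a genuine one.\<close>

definition gibbs_coefficient ::
  "nat \<Rightarrow> (nat \<Rightarrow> 'x::metric_space) measure \<Rightarrow> (nat \<Rightarrow> (nat \<Rightarrow> 'x) \<Rightarrow> 'x measure) \<Rightarrow> real" where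
  "gibbs_coefficient n \<mu> \<kappa> =
     (SUP x\<in>space (data_space n).
        (\<Sum>i<n. tv_dist (marginal \<mu> i) (\<kappa> i (others n i x))) / real n)"

text \<open>Conditional distributions are only determined up to null sets, so \<open>\<psi>(\<mu>)\<close> depends on
  the chosen versions; it suffices that some choice of versions achieves the bound.\<close>

definition gibbs_dependence ::
  "nat \<Rightarrow> real \<Rightarrow> (nat \<Rightarrow> 'x::metric_space) measure \<Rightarrow> bool" where
  "gibbs_dependence n \<psi> \<mu> \<longleftrightarrow>
     (\<exists>\<kappa>. (\<forall>i<n. conditional_version n \<mu> i (\<kappa> i)) \<and> gibbs_coefficient n \<mu> \<kappa> \<le> \<psi>)"


section \<open>Queries and the interactive game\<close>

type_synonym 'x query = "'x \<Rightarrow> bool"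

definition empirical_value :: "nat \<Rightarrow> 'x query \<Rightarrow> (nat \<Rightarrow> 'x) \<Rightarrow> real" where
  "empirical_value n q S = (\<Sum>j<n. of_bool (q (S j))) / real n"

definition query_mean :: "nat \<Rightarrow> 'x query \<Rightarrow> (nat \<Rightarrow> 'x) measure \<Rightarrow> real" where
  "query_mean n q \<mu> = (\<integral>T. empirical_value n q T \<partial>\<mu>)"

text \<open>Randomised parties are given by a distribution of random coins, tossed before the game,
  together with a deterministic strategy for each outcome of the coins. The mechanism's current
  answer may depend on all queries so far including the current one (its own previous
  answers are determined by these, the dataset and the coins). The adversary's current query
  depends on the previous answers. Its coins are real-valued because HOL cannot
  quantify over all coin types inside the definitions below; deterministic adversaries are those
  whose strategy ignores the coins.\<close>

record ('x, 'w) mechanism =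
  mech_coins :: "'w measure"
  respond :: "(nat \<Rightarrow> 'x) \<Rightarrow> 'w \<Rightarrow> 'x query list \<Rightarrow> real"

record 'x adversary =
  adv_coins :: "real measure"
  ask :: "real \<Rightarrow> real list \<Rightarrow> 'x query"

primrec play :: "nat \<Rightarrow> ('x query list \<Rightarrow> real) \<Rightarrow> (real list \<Rightarrow> 'x query) \<Rightarrow> ('x query \<times> real) list"
where
  "play 0 f g = []"
| "play (Suc i) f g =
     (let t = play i f g; q = g (map snd t) in t @ [(q, f (map fst t @ [q]))])"

text \<open>The transcript of \<open>k\<close> rounds on dataset \<open>S\<close>, with coins \<open>w\<close> and \<open>r\<close>: entry \<open>i\<close> is the
  pair of the \<open>i\<close>-th query and its answer.\<close>

definition transcript ::
  "nat \<Rightarrow> ('x, 'w) mechanism \<Rightarrow> 'x adversary \<Rightarrow> (nat \<Rightarrow> 'x) \<Rightarrow> 'w \<times> real \<Rightarrow> nat \<Rightarrow> 'x query \<times> real"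
where
  "transcript k M A S = (\<lambda>(w, r). \<lambda>i\<in>{..<k}. play k (respond M S w) (ask A r) ! i)"

text \<open>Queries carry the sigma-algebra generated by the evaluations \<open>q \<mapsto> q x\<close>.\<close>

definition transcript_space :: "nat \<Rightarrow> (nat \<Rightarrow> 'x query \<times> real) measure" where
  "transcript_space k = PiM {..<k} (\<lambda>_. PiM UNIV (\<lambda>_. count_space UNIV) \<Otimes>\<^sub>M borel)"

definition adversary_wf :: "nat \<Rightarrow> 'x::metric_space adversary \<Rightarrow> bool" where
  "adversary_wf k A \<longleftrightarrow>
     prob_space (adv_coins A) \<and> sets (adv_coins A) = sets borel \<and>
     (\<forall>i<k. (\<lambda>((r, a), x). ask A r (map a [0..<i]) x)
        \<in> (adv_coins A \<Otimes>\<^sub>M PiM {..<i} (\<lambda>_. borel)) \<Otimes>\<^sub>M borel \<rightarrow>\<^sub>M count_space UNIV)"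

abbreviation game_coins :: "('x, 'w) mechanism \<Rightarrow> 'x adversary \<Rightarrow> ('w \<times> real) measure" where
  "game_coins M A \<equiv> mech_coins M \<Otimes>\<^sub>M adv_coins A"

text \<open>The measurability condition says that the interaction with any adversary is a well-defined
  randomised algorithm; without it the probabilities below would be meaningless.\<close>

definition mechanism_wf :: "nat \<Rightarrow> nat \<Rightarrow> ('x::metric_space, 'w) mechanism \<Rightarrow> bool" where
  "mechanism_wf n k M \<longleftrightarrow>
     prob_space (mech_coins M) \<and>
     (\<forall>A. adversary_wf k A \<longrightarrow>
        (\<lambda>(S, c). transcript k M A S c)
          \<in> data_space n \<Otimes>\<^sub>M game_coins M A \<rightarrow>\<^sub>M transcript_space k)"


section \<open>Privacy and accuracy\<close>

definition neighbours :: "nat \<Rightarrow> (nat \<Rightarrow> 'x) \<Rightarrow> (nat \<Rightarrow> 'x) \<Rightarrow> bool" where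
  "neighbours n S S' \<longleftrightarrow> card {i \<in> {..<n}. S i \<noteq> S' i} = 1"

definition differentially_private ::
  "nat \<Rightarrow> real \<Rightarrow> real \<Rightarrow> 'o measure \<Rightarrow> ((nat \<Rightarrow> 'x::metric_space) \<Rightarrow> 'o measure) \<Rightarrow> bool" where
  "differentially_private n \<epsilon> \<delta> Y alg \<longleftrightarrow>
     (\<forall>S\<in>space (data_space n). \<forall>S'\<in>space (data_space n). neighbours n S S' \<longrightarrow>
        (\<forall>E\<in>sets Y. measure (alg S) E \<le> exp \<epsilon> * measure (alg S') E + \<delta>))"

definition private_mechanism ::
  "nat \<Rightarrow> nat \<Rightarrow> real \<Rightarrow> real \<Rightarrow> ('x::metric_space, 'w) mechanism \<Rightarrow> bool" where
  "private_mechanism n k \<epsilon> \<delta> M \<longleftrightarrow>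
     (\<forall>A. adversary_wf k A \<longrightarrow>
        differentially_private n \<epsilon> \<delta> (transcript_space k)
          (\<lambda>S. distr (game_coins M A) (transcript_space k) (transcript k M A S)))"

text \<open>In both accuracy notions, ``the maximal error over the \<open>k\<close> rounds exceeds \<open>\<alpha>\<close>'' is
  written as ``some round has error exceeding \<open>\<alpha>\<close>'', which also makes sense for \<open>k = 0\<close>.\<close>

definition empirically_accurate ::
  "nat \<Rightarrow> nat \<Rightarrow> real \<Rightarrow> real \<Rightarrow> ('x::metric_space, 'w) mechanism \<Rightarrow> bool" where
  "empirically_accurate n k \<alpha> \<beta> M \<longleftrightarrow>
     (\<forall>S\<in>space (data_space n). \<forall>A. adversary_wf k A \<longrightarrow>
        measure (game_coins M A)
          {c \<in> space (game_coins M A).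
             \<exists>i<k. \<bar>empirical_value n (fst (transcript k M A S c i)) S
                     - snd (transcript k M A S c i)\<bar> > \<alpha>} \<le> \<beta>)"

definition statistically_accurate ::
  "nat \<Rightarrow> nat \<Rightarrow> real \<Rightarrow> real \<Rightarrow> ((nat \<Rightarrow> 'x) measure \<Rightarrow> bool) \<Rightarrow>
   ('x::metric_space, 'w) mechanism \<Rightarrow> bool" where
  "statistically_accurate n k \<alpha> \<beta> P M \<longleftrightarrow>
     (\<forall>\<mu>. prob_space \<mu> \<longrightarrow> sets \<mu> = sets (data_space n) \<longrightarrow> P \<mu> \<longrightarrow>
        (\<forall>A. adversary_wf k A \<longrightarrow>
          measure (\<mu> \<Otimes>\<^sub>M game_coins M A)
            {(S, c) \<in> space (\<mu> \<Otimes>\<^sub>M game_coins M A).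
               \<exists>i<k. \<bar>query_mean n (fst (transcript k M A S c i)) \<mu>
                       - snd (transcript k M A S c i)\<bar> > \<alpha>} \<le> \<beta>))"

end

(* Given the transcript, weight each signed query (q_i or its negation) by a softmax of its
   deviation q(S) - q(mu), with rate n * epsilon and a fixed extra weight for selecting nothing. Changing
   one entry of S changes every deviation by at most 1/n, hence the weights by a factor exp (2 * epsilon),
   so "release the transcript, then select" is again differentially private. Replacing entry m of S by a
   fresh draw from its conditional distribution leaves mu invariant, and the conditional distributions
   are on average psi-close to the marginals; hence the expectation of
   (selected deviation) - 3 * epsilon - psi over the event that something is selected is at most delta.
   The integrand is at least -delta everywhere, and at least 2 * epsilon - delta whenever some deviation
   exceeds 10 * epsilon + psi, so the latter has probability at most delta / epsilon. As "nothing" is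
   an option of fixed weight, a single run suffices where the monitor argument uses many parallel ones. *)
theory Submission
  imports Defs
begin

text \<open>For independent samples one compares the dataset with an independent fresh copy. Under
  dependence no such copy is at hand, and a conditional redraw of a single entry takes its place.
  Because the redraw preserves \<open>\<mu>\<close>, the pair (old dataset, fresh value) can be
  traded for (new dataset, its own entry), and privacy pays for this trade: each coordinate costs
  one \<delta>, and the mean over the n coordinates costs one \<delta> again. The selection depends
  on the dataset, so nothing may be averaged over the dataset before comparing marginals with
  conditional laws. The Gibbs condition survives this because it is a supremum over all datasets and
  therefore applies pointwise. Constants: with L = exp (n * \<epsilon>^2), the bound on n says that
  the 2 * k signed queries number at most L * \<delta> / \<epsilon>. The 10 in 10 * \<epsilon> is 1
  + 2 + 7: one \<epsilon> for the privacy of the mechanism, two for the stability of the softmax,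
  seven for outweighing the option of selecting nothing.\<close>

section \<open>Softmax weights\<close>

text \<open>The scores \<open>u\<close> are already shifted by the permitted bias. The constant \<open>exp (2 * c * \<epsilon>)\<close> is the
  weight of selecting nothing: it is large enough that scores below 0 cost at most \<open>\<delta>\<close> in total, and
  small enough that a single score above \<open>7 * \<epsilon>\<close> outweighs it.\<close>

lemma softmax_pointwise:
  fixes u :: "'j \<Rightarrow> real"
  assumes J: "finite J" "card J \<ge> 2" and eps: "0 < \<delta>" "\<delta> \<le> \<epsilon>" and lam: "c > 0"
    and large: "ln (real (card J) * \<epsilon> / \<delta>) \<le> c * \<epsilon>"
  defines "W \<equiv> exp (2 * c * \<epsilon>) + (\<Sum>j\<in>J. exp (c * u j))"
  shows "(\<Sum>j\<in>J. exp (c * u j) / W * u j) \<ge> - \<delta>"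
    and "\<exists>j\<in>J. u j > 7 * \<epsilon> \<Longrightarrow> (\<Sum>j\<in>J. exp (c * u j) / W * u j) \<ge> 2 * \<epsilon> - \<delta>"
proof -
  define N where "N = real (card J)"
  \<comment> \<open>A score of t * \<epsilon> has weight L to the power t, and selecting nothing
    weighs as much as a score of 2 * \<epsilon>. The estimates below compare powers of L.\<close>
  define L where "L = exp (c * \<epsilon>)"
  define T where "T = (\<Sum>j\<in>J. exp (c * u j))"
  have N2: "N \<ge> 2" using J by (simp add: N_def)
  have "\<epsilon> > 0" using eps by simp
  have Npos: "N * \<epsilon> / \<delta> > 0" using N2 eps by simp
  have NL: "N * \<epsilon> / \<delta> \<le> L"
    using large Npos unfolding L_def N_def by (metis exp_le_cancel_iff exp_ln)
  have "N \<le> N * \<epsilon> / \<delta>" using N2 eps by (simp add: field_simps)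
  with NL have NL': "N \<le> L" by simp
  have L2: "L \<ge> 2" using NL' N2 by simp
  have le: "c * \<epsilon> \<ge> 1 / 2"
  proof -
    have "ln 2 \<le> ln L" using L2 by simp
    moreover have "1 / 2 \<le> ln (2 :: real)" using ln_le_minus_one[of "1 / 2 :: real"] by (simp add: ln_div)
    ultimately show ?thesis by (simp add: L_def)
  qed
  have W: "W = L\<^sup>2 + T" by (simp add: W_def L_def T_def exp_double[symmetric] mult.assoc)
  have T0: "T \<ge> 0" unfolding T_def by (intro sum_nonneg) simp
  have W0: "W > 0" using W T0 L2 by (simp add: add_pos_nonneg)
  \<comment> \<open>Each of the N scores lowers the numerator by at most 1 / c, while the
    denominator contains the weight L^2 of selecting nothing. One factor L is matched with N *
    \<epsilon> / \<delta>, the other enters through L * c * \<epsilon> >= 1.\<close>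
  have neg: "N / c \<le> \<delta> * L\<^sup>2"
  proof -
    have "1 \<le> L * (c * \<epsilon>)" using mult_mono[OF L2 le] L2 by simp
    then have "N \<le> N * (L * (c * \<epsilon>))" using N2 by simp
    also have "\<dots> = (N * \<epsilon> / \<delta>) * (\<delta> * L * c)" using eps by (simp add: field_simps)
    also have "\<dots> \<le> L * (\<delta> * L * c)" using NL eps lam L2 by (intro mult_right_mono) auto
    finally show ?thesis using lam by (simp add: field_simps power2_eq_square)
  qed
  have neg': "N / c \<le> \<delta> * W" using neg W T0 eps by (simp add: distrib_left add_increasing2)
  \<comment> \<open>Up to a constant factor this is the minimum of x * exp (c * x); it follows from
    1 + t \<le> exp t at t = - c * x.\<close>
  have low: "exp (c * x) * x \<ge> - 1 / c" for x
  proof -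
    have "1 + - (c * x) \<le> exp (- (c * x))" by (rule exp_ge_add_one_self)
    then have "- (c * x) \<le> exp (- (c * x))" by linarith
    then have "exp (c * x) * (- (c * x)) \<le> exp (c * x) * exp (- (c * x))" by (intro mult_left_mono) auto
    then have "exp (c * x) * (- (c * x)) \<le> 1" by (simp flip: exp_add)
    then show ?thesis using lam by (simp add: field_simps)
  qed
  have sumW: "(\<Sum>j\<in>J. exp (c * u j) / W * u j) = (\<Sum>j\<in>J. exp (c * u j) * u j) / W"
    by (simp add: sum_divide_distrib)
  have "(\<Sum>j\<in>J. exp (c * u j) * u j) \<ge> (\<Sum>j\<in>J. - 1 / c)" by (intro sum_mono low)
  then have "(\<Sum>j\<in>J. exp (c * u j) * u j) \<ge> - \<delta> * W" using neg' by (simp add: N_def)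
  then show "(\<Sum>j\<in>J. exp (c * u j) / W * u j) \<ge> - \<delta>"
    unfolding sumW using W0 by (simp add: field_simps)
  assume "\<exists>j\<in>J. u j > 7 * \<epsilon>"
  then obtain j where j: "j \<in> J" "u j > 7 * \<epsilon>" by blast
  have "L ^ 7 = exp (c * (7 * \<epsilon>))" by (simp add: L_def exp_of_nat_mult[symmetric] mult_ac)
  also have "\<dots> \<le> exp (c * u j)" using j lam by simp
  also have "\<dots> \<le> T" unfolding T_def using J j by (intro member_le_sum) auto
  finally have T7: "L ^ 7 \<le> T" .
  \<comment> \<open>Scores are split at 4 * \<epsilon>, twice the gain that is claimed. Above it a
    score earns 4 * \<epsilon> per unit of weight; below it the weight is at most L^4, so the
    subtracted L^4 makes the first term nonpositive and \<open>low\<close> covers the rest.\<close>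
  have "exp (c * x) * x \<ge> 4 * \<epsilon> * (exp (c * x) - L ^ 4) - 1 / c" for x
  proof (cases "x \<ge> 4 * \<epsilon>")
    case True
    then have "x * exp (c * x) \<ge> (4 * \<epsilon>) * exp (c * x)" by (intro mult_right_mono) auto
    moreover have "4 * \<epsilon> * L ^ 4 + 1 / c \<ge> 0" using \<open>\<epsilon> > 0\<close> L2 lam by simp
    ultimately show ?thesis unfolding right_diff_distrib by (simp only: mult.commute[of x])
  next
    case False
    have "exp (c * x) \<le> exp (c * (4 * \<epsilon>))" using False lam by simp
    also have "\<dots> = L ^ 4" by (simp add: L_def exp_of_nat_mult[symmetric] mult_ac)
    finally have "4 * \<epsilon> * (exp (c * x) - L ^ 4) \<le> 0" using \<open>\<epsilon> > 0\<close>
      by (simp add: mult_le_0_iff)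
    then show ?thesis using low[of x] by simp
  qed
  then have "(\<Sum>j\<in>J. exp (c * u j) * u j) \<ge> (\<Sum>j\<in>J. 4 * \<epsilon> * (exp (c * u j) - L ^ 4) - 1 / c)"
    by (intro sum_mono)
  also have "(\<Sum>j\<in>J. 4 * \<epsilon> * (exp (c * u j) - L ^ 4) - 1 / c) = 4 * \<epsilon> * (T - N * L ^ 4) - N / c"
    by (simp add: sum_subtractf T_def N_def sum_distrib_left[symmetric])
  finally have "(\<Sum>j\<in>J. exp (c * u j) * u j) \<ge> 4 * \<epsilon> * (T - N * L ^ 4) - N / c" .
  \<comment> \<open>The exponent 7 is 4 + 1 + 2: the correction for the split is N * L^4 \<le> L^5
    by N \<le> L, and two more powers give L^7 \<ge> 4 * L^5, which makes T large enough to absorb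
    both L^5 and the weight L^2 of selecting nothing.\<close>
  moreover have "4 * \<epsilon> * (T - N * L ^ 4) \<ge> 2 * \<epsilon> * W"
  proof -
    have "N * L ^ 4 \<le> L * L ^ 4" using NL' L2 by (intro mult_right_mono) auto
    then have a: "N * L ^ 4 \<le> L ^ 5" by (simp add: power_Suc[symmetric] del: power_Suc)
    have "4 * L ^ 5 \<le> L ^ 2 * L ^ 5" using power_mono[OF L2, of 2] L2 by (intro mult_right_mono) auto
    then have b: "4 * L ^ 5 \<le> L ^ 7" by (simp flip: power_add)
    have "0 \<le> L ^ 5" using L2 by simp
    have c: "L ^ 2 \<le> L ^ 5" using L2 by (intro power_increasing) auto
    have arith: "A \<le> B \<Longrightarrow> 4 * B \<le> C \<Longrightarrow> D \<le> B \<Longrightarrow> C \<le> T \<Longrightarrow> 0 \<le> B \<Longrightarrow> D + T \<le> 2 * (T - A)"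
      for A B C D unfolding right_diff_distrib by linarith
    have "2 * (T - N * L ^ 4) \<ge> W" unfolding W
      by (rule arith[OF a b c T7 \<open>0 \<le> L ^ 5\<close>])
    then show ?thesis using \<open>\<epsilon> > 0\<close> by simp
  qed
  ultimately have "(\<Sum>j\<in>J. exp (c * u j) * u j) \<ge> (2 * \<epsilon> - \<delta>) * W"
    using neg' by (simp add: algebra_simps)
  then show "(\<Sum>j\<in>J. exp (c * u j) / W * u j) \<ge> 2 * \<epsilon> - \<delta>"
    unfolding sumW using W0 by (simp add: field_simps)
qed

text \<open>The privacy computation for the exponential mechanism with an extra option of fixed
  weight: numerator and denominator change by a factor \<open>exp \<eta>\<close> each, and the
  constant \<open>c\<close> in the denominator does no harm because \<eta> is nonnegative.\<close>

lemma softmax_stable: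
  fixes u v :: "'j \<Rightarrow> real"
  assumes J: "finite J" "i \<in> J" and c: "c > 0" and uv: "\<And>j. j \<in> J \<Longrightarrow> \<bar>u j - v j\<bar> \<le> \<eta>"
  shows "exp (u i) / (c + (\<Sum>j\<in>J. exp (u j))) \<le> exp (2 * \<eta>) * (exp (v i) / (c + (\<Sum>j\<in>J. exp (v j))))"
proof -
  have eta: "\<eta> \<ge> 0" using uv[OF J(2)] by linarith
  have num: "exp (u i) \<le> exp \<eta> * exp (v i)" using uv[OF J(2)] by (simp flip: exp_add)
  have "c + (\<Sum>j\<in>J. exp (v j)) \<le> exp \<eta> * c + (\<Sum>j\<in>J. exp \<eta> * exp (u j))"
    using uv eta c by (intro add_mono sum_mono) (force simp flip: exp_add simp: abs_le_iff)+
  then have den: "c + (\<Sum>j\<in>J. exp (v j)) \<le> exp \<eta> * (c + (\<Sum>j\<in>J. exp (u j)))"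
    by (simp add: distrib_left sum_distrib_left)
  have pos: "c + (\<Sum>j\<in>J. exp (w j)) > 0" for w using c by (intro add_pos_nonneg sum_nonneg) auto
  have "exp (u i) / (c + (\<Sum>j\<in>J. exp (u j))) \<le> (exp \<eta> * exp (v i)) / ((c + (\<Sum>j\<in>J. exp (v j))) / exp \<eta>)"
    using num den pos by (intro frac_le) (auto simp: field_simps)
  also have "\<dots> = exp (2 * \<eta>) * (exp (v i) / (c + (\<Sum>j\<in>J. exp (v j))))"
    by (simp add: exp_double power2_eq_square)
  finally show ?thesis .
qed

section \<open>Total variation and conditional distributions\<close>

lemma abs_measure_diff_le_1:
  assumes "prob_space p" "prob_space r"
  shows "\<bar>measure p A - measure r A\<bar> \<le> 1"
  using prob_space.prob_le_1[OF assms(1), of A] prob_space.prob_le_1[OF assms(2), of A]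
    measure_nonneg[of p A] measure_nonneg[of r A] by linarith

lemma tv_dist_ge:
  assumes "prob_space p" "prob_space r" "A \<in> sets p"
  shows "\<bar>measure p A - measure r A\<bar> \<le> tv_dist p r"
proof -
  have "bdd_above ((\<lambda>A. \<bar>measure p A - measure r A\<bar>) ` sets p)"
    using abs_measure_diff_le_1[OF assms(1,2)] by (intro bdd_aboveI[of _ 1]) auto
  then show ?thesis unfolding tv_dist_def using assms(3) by (intro cSUP_upper)
qed

lemma tv_dist_le_1: "prob_space p \<Longrightarrow> prob_space r \<Longrightarrow> tv_dist p r \<le> 1"
  unfolding tv_dist_def by (intro cSUP_least abs_measure_diff_le_1) auto

section \<open>Resampling one coordinate from its conditional law\<close>

lemma measurable_resample:
  assumes "m < n"
  shows "(\<lambda>(x, y). x(m := y)) \<in> data_space n \<Otimes>\<^sub>M borel \<rightarrow>\<^sub>M data_space n"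
proof -
  have "insert m {..<n} = {..<n}" using assms by auto
  then show ?thesis using measurable_add_dim[of m "{..<n}" "\<lambda>_. borel"] by simp
qed

lemma measurable_others [measurable]:
  "others n m \<in> data_space n \<rightarrow>\<^sub>M coords_space ({..<n} - {m})"
  unfolding others_def[abs_def] by (rule measurable_restrict_subset) auto

text \<open>One step of a Gibbs sampler. The defining equation of \<open>conditional_version\<close>
  speaks only of events that split into a condition on coordinate \<open>m\<close> and one on the
  others; boxes are of this kind, and they determine a finite measure on the product.\<close>

lemma distr_resample_eq:
  fixes \<mu> :: "(nat \<Rightarrow> 'x::metric_space) measure"
  assumes \<mu>: "prob_space \<mu>" and sets: "sets \<mu> = sets (data_space n)" and m: "m < n"
    and cv: "conditional_version n \<mu> m \<kappa>"
  defines "R \<equiv> \<lambda>x. distr (\<kappa> (others n m x)) (data_space n) (\<lambda>y. x(m := y))"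
  shows "R \<in> \<mu> \<rightarrow>\<^sub>M subprob_algebra (data_space n)" and "\<mu> \<bind> R = \<mu>"
proof -
  interpret prob_space \<mu> by fact
  note [measurable_cong] = sets
  have sp: "space \<mu> = space (data_space n)" using sets by (rule sets_eq_imp_space_eq)
  note [measurable] = measurable_resample[OF m]
  have [measurable]: "\<kappa> \<in> coords_space ({..<n} - {m}) \<rightarrow>\<^sub>M subprob_algebra borel"
    using cv by (auto simp: conditional_version_def intro: measurable_prob_algebraD)
  have kpr: "prob_space (\<kappa> z)" "sets (\<kappa> z) = sets borel" if "z \<in> space (coords_space ({..<n} - {m}))" for z
    using cv that measurable_space[of \<kappa> _ "prob_algebra borel"]
    by (auto simp: conditional_version_def space_prob_algebra)
  have oth: "others n m x \<in> space (coords_space ({..<n} - {m}))" if "x \<in> space \<mu>" for x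
    using that measurable_space[OF measurable_others] by (simp add: sp)
  show R [measurable]: "R \<in> \<mu> \<rightarrow>\<^sub>M subprob_algebra (data_space n)"
    unfolding R_def by (rule measurable_distr2[where M = borel]) measurable
  show "\<mu> \<bind> R = \<mu>"
  proof (rule measure_eqI_PiM_finite[OF _ _ sets])
    show "sets (\<mu> \<bind> R) = sets (data_space n)"
      by (rule sets_bind) (auto simp: not_empty R_def)
    \<comment> \<open>The whole space is itself a box and the measures are finite, so a constant
      sequence serves as the exhaustion.\<close>
    define A where "A = (\<lambda>_::nat. space (data_space n :: (nat \<Rightarrow> 'x) measure))"
    show "range A \<subseteq> prod_algebra {..<n} (\<lambda>_. borel)"
      using prod_algebraI_finite[of "{..<n}" "\<lambda>_. UNIV" "\<lambda>_. borel"]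
      by (auto simp: A_def space_PiM)
    show "(\<Union>i. A i) = space (data_space n)" by (simp add: A_def)
    show "emeasure (\<mu> \<bind> R) (A i) \<noteq> \<infinity>" for i
    proof -
      interpret S: subprob_space "\<mu> \<bind> R"
        by (rule subprob_space_bind[OF prob_space_imp_subprob_space[OF \<mu>] R])
      show ?thesis by simp
    qed
    fix A :: "nat \<Rightarrow> 'x set" assume A: "\<And>i. i \<in> {..<n} \<Longrightarrow> A i \<in> sets borel"
    define B where "B = Pi\<^sub>E ({..<n} - {m}) A"
    have B [measurable]: "B \<in> sets (coords_space ({..<n} - {m}))"
      unfolding B_def using A by (intro sets_PiM_I_finite) auto
    have [measurable]: "A m \<in> sets borel" using A m by auto
    have PA [measurable]: "Pi\<^sub>E {..<n} A \<in> sets (data_space n)"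
      using A by (intro sets_PiM_I_finite) auto
    \<comment> \<open>The overwritten value \<open>x m\<close> disappears from the condition, so
      that the measure of the box under \<open>R x\<close> is a function of the other coordinates
      only.\<close>
    have mem: "x(m := y) \<in> Pi\<^sub>E {..<n} A \<longleftrightarrow> others n m x \<in> B \<and> y \<in> A m"
      if "x \<in> space \<mu>" for x y
      using that m by (auto simp: sp space_PiM others_def B_def PiE_def Pi_def extensional_def split: if_splits)
    have R_meas: "emeasure (R x) (Pi\<^sub>E {..<n} A) =
        ennreal (indicator B (others n m x) * measure (\<kappa> (others n m x)) (A m))"
      if x: "x \<in> space \<mu>" for x
    proof -
      interpret K: prob_space "\<kappa> (others n m x)" using kpr oth x by blast
      have spK: "space (\<kappa> (others n m x)) = UNIV"
        using sets_eq_imp_space_eq[OF kpr(2)[OF oth[OF x]]] by simp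
      have ms: "(\<lambda>y. x(m := y)) \<in> \<kappa> (others n m x) \<rightarrow>\<^sub>M data_space n"
        unfolding measurable_cong_sets[OF kpr(2)[OF oth[OF x]] refl]
        using measurable_Pair2[OF measurable_resample[OF m], of x] x by (simp add: sp)
      have "emeasure (R x) (Pi\<^sub>E {..<n} A) = emeasure (\<kappa> (others n m x)) {y. x(m := y) \<in> Pi\<^sub>E {..<n} A}"
        unfolding R_def using ms by (subst emeasure_distr) (auto simp: vimage_def spK)
      also have "{y. x(m := y) \<in> Pi\<^sub>E {..<n} A} = (if others n m x \<in> B then A m else {})"
        using mem[OF x] by auto
      finally show ?thesis by (simp add: K.emeasure_eq_measure)
    qed
    have "emeasure (\<mu> \<bind> R) (Pi\<^sub>E {..<n} A) = (\<integral>\<^sup>+x. emeasure (R x) (Pi\<^sub>E {..<n} A) \<partial>\<mu>)"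
      by (rule emeasure_bind[OF not_empty R PA])
    also have "\<dots> = (\<integral>\<^sup>+x. ennreal (indicator B (others n m x) * measure (\<kappa> (others n m x)) (A m)) \<partial>\<mu>)"
      by (intro nn_integral_cong R_meas)
    also have "\<dots> = ennreal (\<integral>x. indicator B (others n m x) * measure (\<kappa> (others n m x)) (A m) \<partial>\<mu>)"
    proof (intro nn_integral_eq_integral integrable_const_bound[where B = 1])
      show "AE x in \<mu>. norm (indicat_real B (others n m x) * measure (\<kappa> (others n m x)) (A m)) \<le> 1"
      proof (rule AE_I2)
        fix x assume x: "x \<in> space \<mu>"
        interpret K: prob_space "\<kappa> (others n m x)" using kpr oth x by blast
        show "norm (indicat_real B (others n m x) * measure (\<kappa> (others n m x)) (A m)) \<le> 1"
          by (auto simp: indicator_def)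
      qed
    qed (auto simp: indicator_def)
    also have "\<dots> = ennreal (measure \<mu> {x \<in> space \<mu>. x m \<in> A m \<and> others n m x \<in> B})"
      using cv B by (simp add: conditional_version_def)
    also have "{x \<in> space \<mu>. x m \<in> A m \<and> others n m x \<in> B} = Pi\<^sub>E {..<n} A"
    proof -
      have "x m \<in> A m \<and> others n m x \<in> B \<longleftrightarrow> x \<in> Pi\<^sub>E {..<n} A" if "x \<in> space \<mu>" for x
        using mem[OF that, of "x m"] by auto
      moreover have "Pi\<^sub>E {..<n} A \<subseteq> space \<mu>" using sets.sets_into_space[OF PA] by (simp add: sp)
      ultimately show ?thesis by blast
    qed
    finally show "emeasure (\<mu> \<bind> R) (Pi\<^sub>E {..<n} A) = emeasure \<mu> (Pi\<^sub>E {..<n} A)"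
      by (simp add: emeasure_eq_measure)
  qed simp
qed

text \<open>The integrand varies with \<open>x\<close> together with the measure. Pushing
  \<open>L x\<close> along \<open>Pair x\<close> gives a kernel on the product space, against which
  one fixed function is integrated.\<close>

lemma borel_measurable_integral_kernel:
  fixes f :: "'a \<Rightarrow> 'b \<Rightarrow> real"
  assumes f: "(\<lambda>(x, y). f x y) \<in> borel_measurable (M \<Otimes>\<^sub>M N)"
    and L: "L \<in> M \<rightarrow>\<^sub>M subprob_algebra N"
  shows "(\<lambda>x. \<integral>y. f x y \<partial>L x) \<in> borel_measurable M"
proof -
  have K: "(\<lambda>x. distr (L x) (M \<Otimes>\<^sub>M N) (Pair x)) \<in> M \<rightarrow>\<^sub>M subprob_algebra (M \<Otimes>\<^sub>M N)"
    by (rule measurable_distr2[OF _ L]) simp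
  have "(\<integral>z. (case z of (x, y) \<Rightarrow> f x y) \<partial>distr (L x) (M \<Otimes>\<^sub>M N) (Pair x)) = (\<integral>y. f x y \<partial>L x)"
    if x: "x \<in> space M" for x
  proof -
    have "Pair x \<in> L x \<rightarrow>\<^sub>M M \<Otimes>\<^sub>M N"
      unfolding measurable_cong_sets[OF subprob_measurableD(2)[OF L x] refl] by (rule measurable_Pair1'[OF x])
    from integral_distr[OF this f] show ?thesis by simp
  qed
  then show ?thesis
    using measurable_compose[OF K integral_measurable_subprob_algebra[OF f]] by (simp cong: measurable_cong)
qed

lemma conditional_version_kernel:
  assumes "conditional_version n \<mu> m \<kappa>"
  shows "\<kappa> \<in> coords_space ({..<n} - {m}) \<rightarrow>\<^sub>M subprob_algebra borel"
    "x \<in> space (data_space n) \<Longrightarrow> prob_space (\<kappa> (others n m x))"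
    "x \<in> space (data_space n) \<Longrightarrow> sets (\<kappa> (others n m x)) = sets borel"
proof -
  have \<kappa>: "\<kappa> \<in> coords_space ({..<n} - {m}) \<rightarrow>\<^sub>M prob_algebra borel"
    using assms by (simp add: conditional_version_def)
  then show "\<kappa> \<in> coords_space ({..<n} - {m}) \<rightarrow>\<^sub>M subprob_algebra borel"
    by (rule measurable_prob_algebraD)
  show "prob_space (\<kappa> (others n m x))" "sets (\<kappa> (others n m x)) = sets borel"
    if "x \<in> space (data_space n)"
    using measurable_space[OF \<kappa> measurable_space[OF measurable_others that]] by (simp_all add: space_prob_algebra)
qed

text \<open>Invariance of \<open>\<mu>\<close> passed from sets to functions. The computation with
  the composed kernel takes place in nonnegative integrals; the bounds 0 and 1 provide the
  integrability for returning to real ones.\<close>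

lemma integral_resample:
  fixes \<mu> :: "(nat \<Rightarrow> 'x::metric_space) measure" and D :: "(nat \<Rightarrow> 'x) \<Rightarrow> real"
  assumes \<mu>: "prob_space \<mu>" and sets: "sets \<mu> = sets (data_space n)" and m: "m < n"
    and cv: "conditional_version n \<mu> m \<kappa>"
    and D [measurable]: "D \<in> borel_measurable (data_space n)"
    and bounds: "\<And>x. x \<in> space \<mu> \<Longrightarrow> 0 \<le> D x \<and> D x \<le> 1"
  shows "(\<integral>x. \<integral>y. D (x(m := y)) \<partial>\<kappa> (others n m x) \<partial>\<mu>) = (\<integral>x. D x \<partial>\<mu>)"
    and "(\<lambda>x. \<integral>y. D (x(m := y)) \<partial>\<kappa> (others n m x)) \<in> borel_measurable \<mu>"
proof -
  interpret prob_space \<mu> by fact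
  note [measurable_cong] = sets
  note [measurable] = conditional_version_kernel(1)[OF cv]
  have sp: "space \<mu> = space (data_space n)" using sets by (rule sets_eq_imp_space_eq)
  have upd: "x(m := y) \<in> space \<mu>" if "x \<in> space \<mu>" for x y
    using measurable_space[OF measurable_resample[OF m], of "(x, y)"] that by (simp add: sp space_pair_measure)
  have ms: "(\<lambda>y. x(m := y)) \<in> \<kappa> (others n m x) \<rightarrow>\<^sub>M data_space n" if "x \<in> space \<mu>" for x
    using measurable_Pair2[OF measurable_resample[OF m], of x] that
    unfolding measurable_cong_sets[OF conditional_version_kernel(3)[OF cv that[unfolded sp]] refl] by (simp add: sp)
  show meas [measurable]: "(\<lambda>x. \<integral>y. D (x(m := y)) \<partial>\<kappa> (others n m x)) \<in> borel_measurable \<mu>"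
  proof (rule borel_measurable_integral_kernel[where N = borel])
    show "(\<lambda>(x, y). D (x(m := y))) \<in> borel_measurable (\<mu> \<Otimes>\<^sub>M borel)"
      using measurable_compose[OF measurable_resample[OF m] D] by (simp add: case_prod_beta' cong: measurable_cong_sets)
    show "(\<lambda>x. \<kappa> (others n m x)) \<in> \<mu> \<rightarrow>\<^sub>M subprob_algebra borel" by measurable
  qed
  have in01: "0 \<le> (\<integral>y. D (x(m := y)) \<partial>\<kappa> (others n m x)) \<and> (\<integral>y. D (x(m := y)) \<partial>\<kappa> (others n m x)) \<le> 1"
    and nn: "(\<integral>\<^sup>+y. ennreal (D (x(m := y))) \<partial>\<kappa> (others n m x)) = ennreal (\<integral>y. D (x(m := y)) \<partial>\<kappa> (others n m x))"
    if x: "x \<in> space \<mu>" for x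
  proof -
    interpret K: prob_space "\<kappa> (others n m x)" using conditional_version_kernel(2)[OF cv] x by (simp add: sp)
    have [measurable]: "(\<lambda>y. D (x(m := y))) \<in> borel_measurable (\<kappa> (others n m x))"
      by (rule measurable_compose[OF ms[OF x] D])
    have b: "0 \<le> D (x(m := y)) \<and> D (x(m := y)) \<le> 1" for y using bounds upd[OF x] by blast
    have int: "integrable (\<kappa> (others n m x)) (\<lambda>y. D (x(m := y)))"
      using b by (intro K.integrable_const_bound[where B = 1]) auto
    show "(\<integral>\<^sup>+y. ennreal (D (x(m := y))) \<partial>\<kappa> (others n m x)) = ennreal (\<integral>y. D (x(m := y)) \<partial>\<kappa> (others n m x))"
      using b int by (intro nn_integral_eq_integral) auto
    show "0 \<le> (\<integral>y. D (x(m := y)) \<partial>\<kappa> (others n m x)) \<and> (\<integral>y. D (x(m := y)) \<partial>\<kappa> (others n m x)) \<le> 1"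
      using b int by (auto intro!: K.integral_le_const)
  qed
  have "ennreal (\<integral>x. D x \<partial>\<mu>) = (\<integral>\<^sup>+x. ennreal (D x) \<partial>\<mu>)"
    using bounds by (intro nn_integral_eq_integral[symmetric] integrable_const_bound[where B = 1]) (auto intro!: AE_I2)
  also have "\<dots> = (\<integral>\<^sup>+x. ennreal (D x) \<partial>(\<mu> \<bind> (\<lambda>x. distr (\<kappa> (others n m x)) (data_space n) (\<lambda>y. x(m := y)))))"
    by (simp only: distr_resample_eq(2)[OF \<mu> sets m cv])
  also have "\<dots> = (\<integral>\<^sup>+x. \<integral>\<^sup>+y. ennreal (D y) \<partial>distr (\<kappa> (others n m x)) (data_space n) (\<lambda>y. x(m := y)) \<partial>\<mu>)"
    by (intro nn_integral_bind[OF _ distr_resample_eq(1)[OF \<mu> sets m cv]]) simp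
  also have "\<dots> = (\<integral>\<^sup>+x. ennreal (\<integral>y. D (x(m := y)) \<partial>\<kappa> (others n m x)) \<partial>\<mu>)"
    using ms by (intro nn_integral_cong) (simp add: nn_integral_distr nn)
  also have "\<dots> = ennreal (\<integral>x. \<integral>y. D (x(m := y)) \<partial>\<kappa> (others n m x) \<partial>\<mu>)"
    using in01 by (intro nn_integral_eq_integral integrable_const_bound[where B = 1]) (auto intro!: AE_I2)
  finally show "(\<integral>x. \<integral>y. D (x(m := y)) \<partial>\<kappa> (others n m x) \<partial>\<mu>) = (\<integral>x. D x \<partial>\<mu>)"
    using in01 bounds by (subst (asm) ennreal_inj) (auto intro!: Bochner_Integration.integral_nonneg_AE AE_I2)
qed

section \<open>Privacy for bounded functions\<close>

text \<open>The height \<open>h x\<close> is the probability that a uniform threshold falls below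
  it; exchanging the integrals does the rest. A threshold with a probability law is chosen so that
  constants integrate to themselves.\<close>

lemma (in prob_space) integral_layer_cake:
  fixes h :: "'a \<Rightarrow> real"
  assumes [measurable]: "h \<in> borel_measurable M" and h: "\<And>x. x \<in> space M \<Longrightarrow> 0 \<le> h x \<and> h x \<le> 1"
  shows "integrable (uniform_measure lborel {0..1::real}) (\<lambda>t. prob {x \<in> space M. t < h x})"
    and "(\<integral>x. h x \<partial>M) = (\<integral>t. prob {x \<in> space M. t < h x} \<partial>uniform_measure lborel {0..1})"
proof -
  define U where "U = uniform_measure lborel {0..1::real}"
  have [measurable_cong]: "sets U = sets borel" by (simp add: U_def)
  have U01: "measure U {t. t < c} = c" if "0 \<le> c" "c \<le> 1" for c
  proof -
    have "{0..1} \<inter> {t. t < c} = {0..<c}" using that by auto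
    then show ?thesis unfolding U_def using that by (subst measure_uniform_measure) auto
  qed
  interpret U: prob_space U unfolding U_def by (rule prob_space_uniform_measure) auto
  interpret P: pair_prob_space M U ..
  define f where "f = (\<lambda>(x, t). indicator {(x, t). t < h x} (x, t) :: real)"
  have [measurable]: "f \<in> borel_measurable (M \<Otimes>\<^sub>M U)" unfolding f_def by measurable
  have int: "integrable (M \<Otimes>\<^sub>M U) f"
    by (rule P.integrable_const_bound[where B = 1]) (auto simp: f_def indicator_def)
  have i1: "(\<integral>t. f (x, t) \<partial>U) = h x" if "x \<in> space M" for x
  proof -
    have "(\<integral>t. f (x, t) \<partial>U) = (\<integral>t. indicator {t. t < h x} t \<partial>U)" by (simp add: f_def indicator_def)
    also have "\<dots> = h x" using U01 h[OF that] by (simp add: U_def)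
    finally show ?thesis .
  qed
  have i2: "(\<integral>x. f (x, t) \<partial>M) = prob {x \<in> space M. t < h x}" for t
  proof -
    have "(\<integral>x. f (x, t) \<partial>M) = (\<integral>x. indicator {x \<in> space M. t < h x} x \<partial>M)"
      by (intro Bochner_Integration.integral_cong) (auto simp: f_def indicator_def)
    then show ?thesis by simp
  qed
  show "integrable (uniform_measure lborel {0..1::real}) (\<lambda>t. prob {x \<in> space M. t < h x})"
    using P.integrable_snd[of "\<lambda>x t. f (x, t)"] int unfolding i2 U_def by simp
  have "(\<integral>x. h x \<partial>M) = (\<integral>x. \<integral>t. f (x, t) \<partial>U \<partial>M)"
    by (intro Bochner_Integration.integral_cong) (auto simp: i1)
  also have "\<dots> = (\<integral>t. \<integral>x. f (x, t) \<partial>M \<partial>U)"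
    using P.Fubini_integral[of "\<lambda>x t. f (x, t)"] int by simp
  finally show "(\<integral>x. h x \<partial>M) = (\<integral>t. prob {x \<in> space M. t < h x} \<partial>uniform_measure lborel {0..1})"
    unfolding i2 U_def .
qed

text \<open>Privacy applies to every superlevel set of \<open>h\<close>. Averaging over a threshold
  that is uniform on the unit interval then charges \<delta> exactly once.\<close>

lemma (in prob_space) dp_integral_le:
  fixes h :: "'o \<Rightarrow> real"
  assumes [measurable]: "f \<in> M \<rightarrow>\<^sub>M Y" "g \<in> M \<rightarrow>\<^sub>M Y" "h \<in> borel_measurable Y"
    and h: "\<And>z. z \<in> space Y \<Longrightarrow> 0 \<le> h z \<and> h z \<le> 1"
    and dp: "\<And>E. E \<in> sets Y \<Longrightarrow>
      prob {c \<in> space M. f c \<in> E} \<le> exp \<epsilon> * prob {c \<in> space M. g c \<in> E} + \<delta>"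
  shows "(\<integral>c. h (f c) \<partial>M) \<le> exp \<epsilon> * (\<integral>c. h (g c) \<partial>M) + \<delta>"
proof -
  define U where "U = uniform_measure lborel {0..1::real}"
  interpret U: prob_space U unfolding U_def by (rule prob_space_uniform_measure) auto
  have f: "f c \<in> space Y" and g: "g c \<in> space Y" if "c \<in> space M" for c
    using that measurable_space[of f M Y] measurable_space[of g M Y] by auto
  have lf: "integrable U (\<lambda>t. prob {x \<in> space M. t < h (f x)})"
      "(\<integral>x. h (f x) \<partial>M) = (\<integral>t. prob {x \<in> space M. t < h (f x)} \<partial>U)"
    unfolding U_def using h f by (intro integral_layer_cake; auto)+
  have lg: "integrable U (\<lambda>t. prob {x \<in> space M. t < h (g x)})"
      "(\<integral>x. h (g x) \<partial>M) = (\<integral>t. prob {x \<in> space M. t < h (g x)} \<partial>U)"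
    unfolding U_def using h g by (intro integral_layer_cake; auto)+
  have "prob {x \<in> space M. t < h (f x)} \<le> exp \<epsilon> * prob {x \<in> space M. t < h (g x)} + \<delta>" for t
  proof -
    have "{z \<in> space Y. t < h z} \<in> sets Y" by measurable
    from dp[OF this] f g show ?thesis by (simp cong: conj_cong)
  qed
  then have "(\<integral>t. prob {x \<in> space M. t < h (f x)} \<partial>U)
      \<le> (\<integral>t. exp \<epsilon> * prob {x \<in> space M. t < h (g x)} + \<delta> \<partial>U)"
    using lf(1) lg(1) by (intro integral_mono) auto
  also have "\<dots> = exp \<epsilon> * (\<integral>t. prob {x \<in> space M. t < h (g x)} \<partial>U) + \<delta>"
    using lg(1) by (simp add: U.prob_space)
  finally show ?thesis by (simp add: lf lg)
qed

section \<open>Deviations of the released queries\<close>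

text \<open>The game is abstracted to a one-shot algorithm: \<open>\<Phi> S c\<close> is the output
  on dataset \<open>S\<close> with coins \<open>c\<close>. Privacy is stated for overwriting one
  entry by an arbitrary value, possibly the old one, so that a random draw can be inserted without
  distinguishing whether it changes the dataset.\<close>

locale private_gibbs =
  fixes n :: nat and \<mu> :: "(nat \<Rightarrow> 'x::metric_space) measure"
    and \<kappa> :: "nat \<Rightarrow> (nat \<Rightarrow> 'x) \<Rightarrow> 'x measure" and \<psi> :: real
    and G :: "'c measure" and Y :: "'o measure" and \<Phi> :: "(nat \<Rightarrow> 'x) \<Rightarrow> 'c \<Rightarrow> 'o"
    and \<epsilon> \<delta> :: real
  assumes prob_\<mu>: "prob_space \<mu>" and sets_\<mu> [measurable_cong]: "sets \<mu> = sets (data_space n)"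
    and prob_G: "prob_space G"
    and \<Phi>: "(\<lambda>z. \<Phi> (fst z) (snd z)) \<in> data_space n \<Otimes>\<^sub>M G \<rightarrow>\<^sub>M Y"
    and dp: "\<And>S m y E. S \<in> space (data_space n) \<Longrightarrow> m < n \<Longrightarrow> E \<in> sets Y \<Longrightarrow>
      measure G {c \<in> space G. \<Phi> S c \<in> E} \<le> exp \<epsilon> * measure G {c \<in> space G. \<Phi> (S(m := y)) c \<in> E} + \<delta>"
    and \<epsilon>: "\<epsilon> > 0" and \<delta>: "\<delta> \<ge> 0"
    and conditional: "\<And>m. m < n \<Longrightarrow> conditional_version n \<mu> m (\<kappa> m)"
    and gibbs: "\<And>S. S \<in> space (data_space n) \<Longrightarrow>
      (\<Sum>i<n. tv_dist (marginal \<mu> i) (\<kappa> i (others n i S))) \<le> \<psi> * real n"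
begin

sublocale \<mu>: prob_space \<mu> by (rule prob_\<mu>)
sublocale G: prob_space G by (rule prob_G)
sublocale P: pair_prob_space \<mu> G ..

abbreviation answer :: "(nat \<Rightarrow> 'x) \<times> 'c \<Rightarrow> 'o" where "answer z \<equiv> \<Phi> (fst z) (snd z)"

lemma space_\<mu>: "space \<mu> = space (data_space n)"
  using sets_\<mu> by (rule sets_eq_imp_space_eq)

lemma measurable_answer [measurable]: "answer \<in> \<mu> \<Otimes>\<^sub>M G \<rightarrow>\<^sub>M Y"
  using \<Phi> by (simp cong: measurable_cong_sets)

lemma answer_space: "z \<in> space (\<mu> \<Otimes>\<^sub>M G) \<Longrightarrow> answer z \<in> space Y"
  using measurable_space[OF measurable_answer] .

lemma measurable_\<Phi>: "S \<in> space (data_space n) \<Longrightarrow> \<Phi> S \<in> G \<rightarrow>\<^sub>M Y"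
  using measurable_Pair2[OF \<Phi>, of S] by simp

lemma upd_space: "S \<in> space (data_space n) \<Longrightarrow> m < n \<Longrightarrow> S(m := y) \<in> space (data_space n)"
  using measurable_space[OF measurable_resample, of m n "(S, y)"] by (simp add: space_pair_measure)

text \<open>Moving entry \<open>m\<close> of the dataset to the fresh value \<open>y\<close> costs a factor \<open>exp \<epsilon>\<close> and \<open>\<delta>\<close> for the
  mechanism and a factor \<open>exp \<eta>\<close> for \<open>F\<close>; afterwards \<open>y\<close> is an ordinary entry of a dataset with law \<open>\<mu>\<close>.\<close>

lemma resampling_integral_le:
  fixes F :: "(nat \<Rightarrow> 'x) \<Rightarrow> 'o \<Rightarrow> 'x \<Rightarrow> real"
  assumes m: "m < n"
    and F [measurable]: "(\<lambda>(S, z, y). F S z y) \<in> borel_measurable (data_space n \<Otimes>\<^sub>M Y \<Otimes>\<^sub>M borel)"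
    and F01: "\<And>S z y. S \<in> space (data_space n) \<Longrightarrow> z \<in> space Y \<Longrightarrow> 0 \<le> F S z y \<and> F S z y \<le> 1"
    and stable: "\<And>S z x y. S \<in> space (data_space n) \<Longrightarrow> z \<in> space Y \<Longrightarrow>
      F S z y \<le> exp \<eta> * F (S(m := x)) z y"
  shows "integrable (\<mu> \<Otimes>\<^sub>M G) (\<lambda>z. \<integral>y. F (fst z) (answer z) y \<partial>\<kappa> m (others n m (fst z)))"
      (is ?int)
    and "(\<integral>z. \<integral>y. F (fst z) (answer z) y \<partial>\<kappa> m (others n m (fst z)) \<partial>(\<mu> \<Otimes>\<^sub>M G))
      \<le> exp (\<epsilon> + \<eta>) * (\<integral>z. F (fst z) (answer z) (fst z m) \<partial>(\<mu> \<Otimes>\<^sub>M G)) + \<delta>" (is ?le)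
proof -
  have \<kappa> [measurable]: "\<kappa> m \<in> coords_space ({..<n} - {m}) \<rightarrow>\<^sub>M subprob_algebra borel"
    and k: "S \<in> space \<mu> \<Longrightarrow> prob_space (\<kappa> m (others n m S))"
      "S \<in> space \<mu> \<Longrightarrow> sets (\<kappa> m (others n m S)) = sets borel" for S
    using conditional_version_kernel[OF conditional[OF m]] by (simp_all add: space_\<mu>)
  have [measurable]: "(\<lambda>S. S m) \<in> data_space n \<rightarrow>\<^sub>M borel"
    using m by (intro measurable_component_singleton) auto
  have Fm: "(\<lambda>x. F (a x) (b x) (c x)) \<in> borel_measurable N"
    if "a \<in> N \<rightarrow>\<^sub>M data_space n" "b \<in> N \<rightarrow>\<^sub>M Y" "c \<in> N \<rightarrow>\<^sub>M borel" for a b c and N :: "'z measure"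
    using measurable_compose[OF measurable_Pair[OF that(1) measurable_Pair[OF that(2,3)]] F] by simp
  \<comment> \<open>\<open>H\<close> tests a fresh value against an output computed from the old
    dataset; \<open>D\<close> tests a dataset's own entry \<open>m\<close>. At
    \<open>S(m := y)\<close> that entry is \<open>y\<close>, which is how the two are
    linked.\<close>
  define H where "H = (\<lambda>z. \<integral>y. F (fst z) (answer z) y \<partial>\<kappa> m (others n m (fst z)))"
  define D where "D = (\<lambda>S. \<integral>c. F S (\<Phi> S c) (S m) \<partial>G)"
  have FP: "0 \<le> F (fst z) (answer z) y \<and> F (fst z) (answer z) y \<le> 1" if "z \<in> space (\<mu> \<Otimes>\<^sub>M G)" for z y
    using that by (intro F01 answer_space) (auto simp: space_pair_measure space_\<mu>)
  have FG: "0 \<le> F S (\<Phi> S c) y \<and> F S (\<Phi> S c) y \<le> 1" if "S \<in> space \<mu>" "c \<in> space G" for S c y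
    using FP[of "(S, c)"] that by (simp add: space_pair_measure)
  have H [measurable]: "H \<in> borel_measurable (\<mu> \<Otimes>\<^sub>M G)"
    unfolding H_def
  proof (rule borel_measurable_integral_kernel[where N = borel])
    show "(\<lambda>(z, y). F (fst z) (answer z) y) \<in> borel_measurable ((\<mu> \<Otimes>\<^sub>M G) \<Otimes>\<^sub>M borel)"
      unfolding case_prod_beta by (intro Fm measurable_compose[OF measurable_fst measurable_answer]) measurable
    show "(\<lambda>z. \<kappa> m (others n m (fst z))) \<in> \<mu> \<Otimes>\<^sub>M G \<rightarrow>\<^sub>M subprob_algebra borel"
      by (rule measurable_compose[OF _ \<kappa>], rule measurable_compose[OF _ measurable_others]) measurable
  qed
  have H01: "0 \<le> H z \<and> H z \<le> 1" if z: "z \<in> space (\<mu> \<Otimes>\<^sub>M G)" for z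
  proof -
    have S: "fst z \<in> space \<mu>" using z by (auto simp: space_pair_measure)
    interpret K: prob_space "\<kappa> m (others n m (fst z))" by (rule k(1)[OF S])
    note [measurable_cong] = k(2)[OF S]
    have "(\<lambda>y. F (fst z) (answer z) y) \<in> borel_measurable (\<kappa> m (others n m (fst z)))"
      using S answer_space[OF z]
      by (intro Fm measurable_const measurable_ident_sets[OF k(2)[OF S]]) (auto simp: space_\<mu>)
    then have "integrable (\<kappa> m (others n m (fst z))) (\<lambda>y. F (fst z) (answer z) y)"
      using FP[OF z] by (intro K.integrable_const_bound[where B = 1]) auto
    then show ?thesis unfolding H_def using FP[OF z] by (auto intro!: K.integral_le_const)
  qed
  have Hint: "integrable (\<mu> \<Otimes>\<^sub>M G) H"
    using H01 by (intro P.integrable_const_bound[where B = 1]) (auto intro!: AE_I2)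
  then show ?int by (simp add: H_def)
  have D [measurable]: "D \<in> borel_measurable (data_space n)"
  proof -
    have "(\<lambda>z. F (fst z) (answer z) (fst z m)) \<in> borel_measurable (data_space n \<Otimes>\<^sub>M G)"
      using \<Phi> by (intro Fm) measurable
    then show ?thesis
      unfolding D_def by (intro G.borel_measurable_lebesgue_integral) (simp add: case_prod_beta)
  qed
  have \<Phi>S: "\<Phi> S \<in> G \<rightarrow>\<^sub>M Y" if "S \<in> space \<mu>" for S
    using measurable_\<Phi> that by (simp add: space_\<mu>)
  have Fint: "integrable G (\<lambda>c. F S (\<Phi> S c) y)" if S: "S \<in> space \<mu>" for S y
    using FG[OF S] S unfolding space_\<mu>
    by (intro G.integrable_const_bound[where B = 1] AE_I2 Fm measurable_\<Phi> measurable_const) auto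
  have D01: "0 \<le> D S \<and> D S \<le> 1" if S: "S \<in> space \<mu>" for S
    unfolding D_def using FG[OF S] Fint[OF S] by (auto intro!: G.integral_le_const)
  have Dupd: "integrable (\<kappa> m (others n m S)) (\<lambda>y. D (S(m := y)))" "0 \<le> D (S(m := y)) \<and> D (S(m := y)) \<le> 1"
    if S: "S \<in> space \<mu>" for S y
  proof -
    interpret K: prob_space "\<kappa> m (others n m S)" by (rule k(1)[OF S])
    have S': "S \<in> space (data_space n)" using S by (simp add: space_\<mu>)
    show *: "0 \<le> D (S(m := y)) \<and> D (S(m := y)) \<le> 1" for y
      using D01 upd_space[OF S' m] by (simp add: space_\<mu>)
    have "(\<lambda>y. S(m := y)) \<in> \<kappa> m (others n m S) \<rightarrow>\<^sub>M data_space n"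
      unfolding measurable_cong_sets[OF k(2)[OF S] refl]
      using measurable_Pair2[OF measurable_resample[OF m] S'] by simp
    from measurable_compose[OF this D] show "integrable (\<kappa> m (others n m S)) (\<lambda>y. D (S(m := y)))"
      using * by (intro K.integrable_const_bound[where B = 1] AE_I2) auto
  qed
  have key: "(\<integral>c. H (S, c) \<partial>G) \<le> exp (\<epsilon> + \<eta>) * (\<integral>y. D (S(m := y)) \<partial>\<kappa> m (others n m S)) + \<delta>"
    if S: "S \<in> space \<mu>" for S
  proof -
    have S': "S \<in> space (data_space n)" using S by (simp add: space_\<mu>)
    interpret K: prob_space "\<kappa> m (others n m S)" by (rule k(1)[OF S])
    note [measurable_cong] = k(2)[OF S]
    interpret KG: pair_prob_space "\<kappa> m (others n m S)" G ..
    define V where "V = (\<lambda>y c. F S (\<Phi> S c) y)"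
    have V [measurable]: "case_prod V \<in> borel_measurable (\<kappa> m (others n m S) \<Otimes>\<^sub>M G)"
      unfolding V_def case_prod_beta
      by (intro Fm measurable_const S' measurable_compose[OF measurable_snd measurable_\<Phi>[OF S']]
          measurable_compose[OF measurable_fst measurable_ident_sets[OF k(2)[OF S]]])
    have Vint: "integrable (\<kappa> m (others n m S) \<Otimes>\<^sub>M G) (case_prod V)"
      using FG[OF S] by (intro KG.integrable_const_bound[where B = 1] AE_I2 V) (auto simp: V_def space_pair_measure)
    have upd: "S(m := y) \<in> space \<mu>" for y using upd_space[OF S' m] by (simp add: space_\<mu>)
    have "(\<integral>c. H (S, c) \<partial>G) = (\<integral>c. \<integral>y. V y c \<partial>\<kappa> m (others n m S) \<partial>G)" by (simp add: H_def V_def)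
    \<comment> \<open>The fresh value goes to the outer integral: privacy compares \<open>S\<close>
      with \<open>S(m := y)\<close> for one fixed \<open>y\<close> while the coins vary.\<close>
    also have "\<dots> = (\<integral>y. \<integral>c. V y c \<partial>G \<partial>\<kappa> m (others n m S))" by (rule KG.Fubini_integral[OF Vint])
    also have "\<dots> \<le> (\<integral>y. exp (\<epsilon> + \<eta>) * D (S(m := y)) + \<delta> \<partial>\<kappa> m (others n m S))"
    proof (rule integral_mono)
      show "integrable (\<kappa> m (others n m S)) (\<lambda>y. \<integral>c. V y c \<partial>G)"
        using KG.integrable_fst'[OF Vint] by simp
      show "integrable (\<kappa> m (others n m S)) (\<lambda>y. exp (\<epsilon> + \<eta>) * D (S(m := y)) + \<delta>)"
        using Dupd(1)[OF S] by simp
      fix y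
      have "(\<integral>c. V y c \<partial>G) \<le> exp \<epsilon> * (\<integral>c. F S (\<Phi> (S(m := y)) c) y \<partial>G) + \<delta>"
        unfolding V_def using S' F01[OF S']
        by (intro G.dp_integral_le[where Y = Y] dp m measurable_\<Phi> upd_space Fm measurable_const) auto
      \<comment> \<open>Privacy has replaced the dataset only inside the output; the copy that
        \<open>F\<close> reads directly is replaced by \<open>stable\<close>. Afterwards
        \<open>F\<close> is evaluated at entry \<open>m\<close> of its own dataset, as in
        \<open>D\<close>.\<close>
      also have "(\<integral>c. F S (\<Phi> (S(m := y)) c) y \<partial>G) \<le> (\<integral>c. exp \<eta> * F (S(m := y)) (\<Phi> (S(m := y)) c) y \<partial>G)"
      proof (rule integral_mono)
        show "integrable G (\<lambda>c. F S (\<Phi> (S(m := y)) c) y)"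
          using F01[OF S' measurable_space[OF \<Phi>S[OF upd]]] S'
          by (intro G.integrable_const_bound[where B = 1] AE_I2 Fm measurable_const \<Phi>S[OF upd]) auto
        show "integrable G (\<lambda>c. exp \<eta> * F (S(m := y)) (\<Phi> (S(m := y)) c) y)"
          using Fint[OF upd] by simp
        show "F S (\<Phi> (S(m := y)) c) y \<le> exp \<eta> * F (S(m := y)) (\<Phi> (S(m := y)) c) y" if "c \<in> space G" for c
          using measurable_space[OF \<Phi>S[OF upd] that] by (intro stable S') auto
      qed
      also have "\<dots> = exp \<eta> * D (S(m := y))" by (simp add: D_def)
      finally show "(\<integral>c. V y c \<partial>G) \<le> exp (\<epsilon> + \<eta>) * D (S(m := y)) + \<delta>"
        by (simp add: exp_add mult.assoc)
    qed
    also have "\<dots> = exp (\<epsilon> + \<eta>) * (\<integral>y. D (S(m := y)) \<partial>\<kappa> m (others n m S)) + \<delta>"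
      using Dupd(1)[OF S] by (simp add: K.prob_space)
    finally show ?thesis .
  qed
  note res = integral_resample[OF prob_\<mu> sets_\<mu> m conditional[OF m] D D01]
  have res01: "0 \<le> (\<integral>y. D (S(m := y)) \<partial>\<kappa> m (others n m S)) \<and> (\<integral>y. D (S(m := y)) \<partial>\<kappa> m (others n m S)) \<le> 1"
    if S: "S \<in> space \<mu>" for S
  proof -
    interpret K: prob_space "\<kappa> m (others n m S)" by (rule k(1)[OF S])
    show ?thesis using Dupd[OF S] by (auto intro!: K.integral_le_const)
  qed
  have resint: "integrable \<mu> (\<lambda>S. \<integral>y. D (S(m := y)) \<partial>\<kappa> m (others n m S))"
    using res01 by (intro \<mu>.integrable_const_bound[where B = 1] AE_I2 res(2)) auto
  have DFub: "(\<integral>z. F (fst z) (answer z) (fst z m) \<partial>(\<mu> \<Otimes>\<^sub>M G)) = (\<integral>S. D S \<partial>\<mu>)"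
  proof -
    have "(\<lambda>z. F (fst z) (answer z) (fst z m)) \<in> borel_measurable (\<mu> \<Otimes>\<^sub>M G)"
      by (intro Fm measurable_answer) measurable
    then have "integrable (\<mu> \<Otimes>\<^sub>M G) (\<lambda>z. F (fst z) (answer z) (fst z m))"
      using FP by (intro P.integrable_const_bound[where B = 1] AE_I2) auto
    from P.integral_fst'[OF this] show ?thesis by (simp add: D_def)
  qed
  have "(\<integral>z. H z \<partial>(\<mu> \<Otimes>\<^sub>M G)) = (\<integral>S. \<integral>c. H (S, c) \<partial>G \<partial>\<mu>)"
    by (rule P.integral_fst'[OF Hint, symmetric])
  also have "\<dots> \<le> (\<integral>S. exp (\<epsilon> + \<eta>) * (\<integral>y. D (S(m := y)) \<partial>\<kappa> m (others n m S)) + \<delta> \<partial>\<mu>)"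
    using P.integrable_fst'[OF Hint] resint by (intro integral_mono key) auto
  also have "\<dots> = exp (\<epsilon> + \<eta>) * (\<integral>S. D S \<partial>\<mu>) + \<delta>"
    using resint by (simp add: res(1) \<mu>.prob_space)
  finally show ?le by (simp add: H_def DFub)
qed

text \<open>The mean is written through the marginals so that it can be compared with the
  conditional kernels coordinate by coordinate. For measurable queries this is the empirical value
  minus \<open>query_mean\<close>.\<close>

definition deviation :: "('o \<Rightarrow> 'x \<Rightarrow> bool) \<Rightarrow> (nat \<Rightarrow> 'x) \<Rightarrow> 'o \<Rightarrow> real" where
  "deviation q S z = (\<Sum>m<n. of_bool (q z (S m)) - measure (marginal \<mu> m) {y. q z y}) / real n"

lemma prob_marginal: "m < n \<Longrightarrow> prob_space (marginal \<mu> m)"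
  unfolding marginal_def
  by (intro \<mu>.prob_space_distr) (simp add: measurable_cong_sets[OF sets_\<mu> refl])

lemma kernel_prob:
  assumes "m < n" "S \<in> space (data_space n)"
  shows "prob_space (\<kappa> m (others n m S))" "sets (\<kappa> m (others n m S)) = sets borel"
  using conditional_version_kernel(2,3)[OF conditional[OF assms(1)] assms(2)] by auto

section \<open>A query selected at random from output and dataset\<close>

context
  fixes J :: "'j set" and q :: "'j \<Rightarrow> 'o \<Rightarrow> 'x \<Rightarrow> bool"
  assumes J: "finite J"
    and q: "\<And>j. j \<in> J \<Longrightarrow> Measurable.pred (Y \<Otimes>\<^sub>M borel) (\<lambda>(z, x). q j z x)"
begin

lemma query_sets: "j \<in> J \<Longrightarrow> z \<in> space Y \<Longrightarrow> {y. q j z y} \<in> sets borel"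
  using measurable_Pair2[OF q, of j z] by (simp add: pred_def)

lemma measurable_query [measurable (raw)]:
  assumes "j \<in> J" "a \<in> N \<rightarrow>\<^sub>M Y" "b \<in> N \<rightarrow>\<^sub>M borel"
  shows "Measurable.pred N (\<lambda>w. q j (a w) (b w))"
  using measurable_compose[OF measurable_Pair[OF assms(2,3)] q[OF assms(1)]] by simp

text \<open>Set and law both vary with \<open>w\<close>; the sets are the sections of a measurable
  subset of the product. A varying \<open>L\<close> covers the conditional kernels, a constant one
  the marginals.\<close>

lemma measurable_measure_query:
  assumes j: "j \<in> J" and a: "a \<in> N \<rightarrow>\<^sub>M Y" and L: "L \<in> N \<rightarrow>\<^sub>M subprob_algebra borel"
  shows "(\<lambda>w. measure (L w) {y. q j (a w) y}) \<in> borel_measurable N"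
proof (rule measure_measurable_subprob_algebra2[OF _ L])
  have "Measurable.pred (N \<Otimes>\<^sub>M borel) (\<lambda>w. q j (a (fst w)) (snd w))"
    by (intro measurable_query[OF j] measurable_compose[OF measurable_fst a] measurable_snd)
  then have "{w \<in> space (N \<Otimes>\<^sub>M borel). q j (a (fst w)) (snd w)} \<in> sets (N \<Otimes>\<^sub>M borel)"
    by (simp add: pred_def)
  also have "{w \<in> space (N \<Otimes>\<^sub>M borel). q j (a (fst w)) (snd w)} = (SIGMA w:space N. {y. q j (a w) y})"
    by (auto simp: space_pair_measure)
  finally show "(SIGMA w:space N. {y. q j (a w) y}) \<in> sets (N \<Otimes>\<^sub>M borel)" .
qed

lemma measurable_deviation [measurable]:
  assumes j: "j \<in> J"
  shows "(\<lambda>w. deviation (q j) (fst w) (snd w)) \<in> borel_measurable (data_space n \<Otimes>\<^sub>M Y)"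
proof -
  have 1: "(\<lambda>w. of_bool (q j (snd w) (fst w m)) :: real) \<in> borel_measurable (data_space n \<Otimes>\<^sub>M Y)" if "m < n" for m
  proof -
    have "Measurable.pred (data_space n \<Otimes>\<^sub>M Y) (\<lambda>w. q j (snd w) (fst w m))"
      using that by (intro measurable_query[OF j] measurable_compose[OF measurable_fst measurable_component_singleton]) auto
    then show ?thesis by (rule measurable_compose) simp
  qed
  have 2: "(\<lambda>w. measure (marginal \<mu> m) {y. q j (snd w) y}) \<in> borel_measurable (data_space n \<Otimes>\<^sub>M Y)" if "m < n" for m
    using prob_marginal[OF that]
    by (intro measurable_measure_query j measurable_snd measurable_const)
       (simp add: space_subprob_algebra marginal_def prob_space_imp_subprob_space)
  show ?thesis
    unfolding deviation_def using 1 2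
    by (intro borel_measurable_divide borel_measurable_sum borel_measurable_diff) auto
qed

text \<open>Think of \<open>p j S z\<close> as the probability of selecting query \<open>j\<close>. Bounding the complementary queries
  instead of the queries themselves gives the bias \<open>1 - exp (- (\<epsilon> + \<eta>)) \<le> \<epsilon> + \<eta>\<close> rather than
  \<open>exp (\<epsilon> + \<eta>) - 1\<close>.\<close>

lemma selection_bound:
  fixes p :: "'j \<Rightarrow> (nat \<Rightarrow> 'x) \<Rightarrow> 'o \<Rightarrow> real"
  assumes n: "n > 0" and \<eta>: "\<eta> \<ge> 0"
    and p [measurable]: "\<And>j. j \<in> J \<Longrightarrow> (\<lambda>w. p j (fst w) (snd w)) \<in> borel_measurable (data_space n \<Otimes>\<^sub>M Y)"
    and p0: "\<And>j S z. j \<in> J \<Longrightarrow> 0 \<le> p j S z"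
    and p1: "\<And>S z. (\<Sum>j\<in>J. p j S z) \<le> 1"
    and stable: "\<And>j S z m x. j \<in> J \<Longrightarrow> S \<in> space (data_space n) \<Longrightarrow> z \<in> space Y \<Longrightarrow> m < n \<Longrightarrow>
      p j S z \<le> exp \<eta> * p j (S(m := x)) z"
  shows "integrable (\<mu> \<Otimes>\<^sub>M G) (\<lambda>w. \<Sum>j\<in>J. p j (fst w) (answer w) * (deviation (q j) (fst w) (answer w) - (\<epsilon> + \<eta> + \<psi>)))"
    and "(\<integral>w. (\<Sum>j\<in>J. p j (fst w) (answer w) * (deviation (q j) (fst w) (answer w) - (\<epsilon> + \<eta> + \<psi>))) \<partial>(\<mu> \<Otimes>\<^sub>M G)) \<le> \<delta>"
proof -
  define e where "e = \<epsilon> + \<eta>"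
  have e: "e \<ge> 0" using \<epsilon> \<eta> by (simp add: e_def)
  \<comment> \<open>\<open>A m\<close> is the gap between entry \<open>m\<close> and its conditional
    law, weighted by the selection; \<open>W\<close> is the probability that anything is
    selected.\<close>
  define A where "A = (\<lambda>m w. \<Sum>j\<in>J. p j (fst w) (answer w) *
     (of_bool (q j (answer w) (fst w m)) - measure (\<kappa> m (others n m (fst w))) {y. q j (answer w) y}))"
  define W where "W = (\<lambda>w. \<Sum>j\<in>J. p j (fst w) (answer w))"
  define B where "B = (\<lambda>w. \<Sum>j\<in>J. p j (fst w) (answer w) * (deviation (q j) (fst w) (answer w) - (\<epsilon> + \<eta> + \<psi>)))"
  have sp: "fst w \<in> space (data_space n)" "answer w \<in> space Y" if "w \<in> space (\<mu> \<Otimes>\<^sub>M G)" for w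
    using that answer_space[OF that] by (auto simp: space_pair_measure space_\<mu>)
  have pj1: "p j S z \<le> 1" if "j \<in> J" for j S z
    using order_trans[OF member_le_sum[OF that _ J, of "\<lambda>j. p j S z"] p1] p0 by auto
  have pair: "(\<lambda>w. (fst w, answer w)) \<in> \<mu> \<Otimes>\<^sub>M G \<rightarrow>\<^sub>M data_space n \<Otimes>\<^sub>M Y"
    by (intro measurable_Pair measurable_answer) measurable
  have pm: "(\<lambda>w. p j (fst w) (answer w)) \<in> borel_measurable (\<mu> \<Otimes>\<^sub>M G)" if "j \<in> J" for j
    using measurable_compose[OF pair p[OF that]] by simp
  have bounded: "integrable (\<mu> \<Otimes>\<^sub>M G) (\<lambda>w. p j (fst w) (answer w) * g w)"
    if "j \<in> J" "g \<in> borel_measurable (\<mu> \<Otimes>\<^sub>M G)" "\<And>w. w \<in> space (\<mu> \<Otimes>\<^sub>M G) \<Longrightarrow> \<bar>g w\<bar> \<le> C" for j g C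
  proof (rule P.integrable_const_bound[where B = C])
    show "AE w in \<mu> \<Otimes>\<^sub>M G. norm (p j (fst w) (answer w) * g w) \<le> C"
    proof (rule AE_I2)
      fix w assume w: "w \<in> space (\<mu> \<Otimes>\<^sub>M G)"
      have "\<bar>p j (fst w) (answer w)\<bar> * \<bar>g w\<bar> \<le> 1 * C"
        using p0[OF that(1)] pj1[OF that(1)] that(3)[OF w] by (intro mult_mono) auto
      then show "norm (p j (fst w) (answer w) * g w) \<le> C" by (simp add: abs_mult)
    qed
    show "(\<lambda>w. p j (fst w) (answer w) * g w) \<in> borel_measurable (\<mu> \<Otimes>\<^sub>M G)"
      using pm that(1,2) by simp
  qed
  have Wint: "integrable (\<mu> \<Otimes>\<^sub>M G) W"
    unfolding W_def using bounded[of _ "\<lambda>_. 1" 1] by (intro Bochner_Integration.integrable_sum) simp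
  have comp: "(\<lambda>w. fst w m) \<in> \<mu> \<Otimes>\<^sub>M G \<rightarrow>\<^sub>M borel" if "m < n" for m
    by (rule measurable_compose[OF measurable_fst])
       (use that in \<open>simp add: measurable_cong_sets[OF sets_\<mu> refl]\<close>)
  have kern: "(\<lambda>w. \<kappa> m (others n m (fst w))) \<in> \<mu> \<Otimes>\<^sub>M G \<rightarrow>\<^sub>M subprob_algebra borel" if "m < n" for m
    by (rule measurable_compose[OF measurable_fst], rule measurable_compose[OF _ conditional_version_kernel(1)[OF conditional[OF that]]])
       (simp add: measurable_cong_sets[OF sets_\<mu> refl])
  have Aint: "integrable (\<mu> \<Otimes>\<^sub>M G) (A m)" if m: "m < n" for m
    unfolding A_def
  proof (intro Bochner_Integration.integrable_sum bounded[of _ _ 1])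
    fix j assume j: "j \<in> J"
    show "(\<lambda>w. of_bool (q j (answer w) (fst w m)) - measure (\<kappa> m (others n m (fst w))) {y. q j (answer w) y})
        \<in> borel_measurable (\<mu> \<Otimes>\<^sub>M G)"
    proof (rule borel_measurable_diff)
      have "Measurable.pred (\<mu> \<Otimes>\<^sub>M G) (\<lambda>w. q j (answer w) (fst w m))"
        by (intro measurable_query j measurable_answer comp m)
      then show "(\<lambda>w. of_bool (q j (answer w) (fst w m)) :: real) \<in> borel_measurable (\<mu> \<Otimes>\<^sub>M G)"
        by (rule measurable_compose) simp
      show "(\<lambda>w. measure (\<kappa> m (others n m (fst w))) {y. q j (answer w) y}) \<in> borel_measurable (\<mu> \<Otimes>\<^sub>M G)"
        by (intro measurable_measure_query j measurable_answer kern m)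
    qed
    fix w assume w: "w \<in> space (\<mu> \<Otimes>\<^sub>M G)"
    interpret K: prob_space "\<kappa> m (others n m (fst w))" using kernel_prob(1)[OF m] sp[OF w] by blast
    show "\<bar>of_bool (q j (answer w) (fst w m)) - measure (\<kappa> m (others n m (fst w))) {y. q j (answer w) y}\<bar> \<le> 1"
      using K.prob_le_1[of "{y. q j (answer w) y}"] measure_nonneg[of "\<kappa> m (others n m (fst w))" "{y. q j (answer w) y}"]
      by (auto simp: of_bool_def)
  qed
  \<comment> \<open>The bias is charged in proportion to \<open>W\<close> and not as a constant,
    because \<open>B\<close> subtracts it only to the extent that something is selected.\<close>
  have A: "(\<integral>w. A m w \<partial>(\<mu> \<Otimes>\<^sub>M G)) \<le> e * (\<integral>w. W w \<partial>(\<mu> \<Otimes>\<^sub>M G)) + \<delta>" if m: "m < n" for m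
  proof -
    \<comment> \<open>One test function for all queries together: the probability that a query is
      selected and rejects \<open>y\<close>. Hence \<delta> is paid once per coordinate instead of
      once per query.\<close>
    define F where "F = (\<lambda>S z y. \<Sum>j\<in>J. p j S z * of_bool (\<not> q j z y))"
    have F: "(\<lambda>(S, z, y). F S z y) \<in> borel_measurable (data_space n \<Otimes>\<^sub>M Y \<Otimes>\<^sub>M borel)"
    proof -
      have "(\<lambda>w. p j (fst w) (fst (snd w)) * of_bool (\<not> q j (fst (snd w)) (snd (snd w))))
          \<in> borel_measurable (data_space n \<Otimes>\<^sub>M Y \<Otimes>\<^sub>M borel)" if j: "j \<in> J" for j
      proof (rule borel_measurable_times)
        have "(\<lambda>w. (fst w, fst (snd w))) \<in> data_space n \<Otimes>\<^sub>M Y \<Otimes>\<^sub>M (borel :: 'x measure) \<rightarrow>\<^sub>M data_space n \<Otimes>\<^sub>M Y" by measurable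
        from measurable_compose[OF this p[OF j]]
        show "(\<lambda>w. p j (fst w) (fst (snd w))) \<in> borel_measurable (data_space n \<Otimes>\<^sub>M Y \<Otimes>\<^sub>M (borel :: 'x measure))" by simp
        have "Measurable.pred (data_space n \<Otimes>\<^sub>M Y \<Otimes>\<^sub>M borel) (\<lambda>w. q j (fst (snd w)) (snd (snd w)))"
          by (intro measurable_query j measurable_compose[OF measurable_snd measurable_fst] measurable_compose[OF measurable_snd measurable_snd])
        then show "(\<lambda>w. of_bool (\<not> q j (fst (snd w)) (snd (snd w))) :: real) \<in> borel_measurable (data_space n \<Otimes>\<^sub>M Y \<Otimes>\<^sub>M borel)"
          by (rule measurable_compose) simp
      qed
      then show ?thesis by (simp add: F_def case_prod_beta)
    qed
    have F01: "0 \<le> F S z y \<and> F S z y \<le> 1" for S z y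
    proof
      show "0 \<le> F S z y" unfolding F_def using p0 by (intro sum_nonneg) auto
      have "F S z y \<le> (\<Sum>j\<in>J. p j S z)" unfolding F_def using p0 by (intro sum_mono) auto
      then show "F S z y \<le> 1" using p1 by (rule order_trans)
    qed
    have Fst: "F S z y \<le> exp \<eta> * F (S(m := x)) z y" if "S \<in> space (data_space n)" "z \<in> space Y" for S z x y
      unfolding F_def sum_distrib_left mult.assoc[symmetric] using stable[OF _ that m]
      by (intro sum_mono mult_right_mono) auto
    \<comment> \<open>Passing to complements flips the sign: what the fresh draw gains over the
      entry itself is exactly \<open>A m w\<close>.\<close>
    have inner: "(\<integral>y. F (fst w) (answer w) y \<partial>\<kappa> m (others n m (fst w))) = F (fst w) (answer w) (fst w m) + A m w
        \<and> (\<integral>y. F (fst w) (answer w) y \<partial>\<kappa> m (others n m (fst w))) \<le> W w"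
      if w: "w \<in> space (\<mu> \<Otimes>\<^sub>M G)" for w
    proof -
      interpret K: prob_space "\<kappa> m (others n m (fst w))" using kernel_prob(1)[OF m] sp[OF w] by blast
      have Ks: "sets (\<kappa> m (others n m (fst w))) = sets borel" using kernel_prob(2)[OF m] sp[OF w] by blast
      have Ksp: "space (\<kappa> m (others n m (fst w))) = UNIV" using sets_eq_imp_space_eq[OF Ks] by simp
      have qs: "{y. q j (answer w) y} \<in> K.events" if "j \<in> J" for j
        using query_sets[OF that sp(2)[OF w]] by (simp add: Ks)
      have *: "of_bool (\<not> q j (answer w) y) = (1 :: real) - indicator {y. q j (answer w) y} y" for j y
        by (simp add: indicator_def)
      have int: "integrable (\<kappa> m (others n m (fst w))) (\<lambda>y. 1 - indicat_real {y. q j (answer w) y} y)"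
        "K.expectation (\<lambda>y. 1 - indicat_real {y. q j (answer w) y} y) = 1 - K.prob {y. q j (answer w) y}"
        if "j \<in> J" for j
      proof -
        have "integrable (\<kappa> m (others n m (fst w))) (indicat_real {y. q j (answer w) y})"
          using qs[OF that] by (intro integrable_real_indicator) (auto simp: K.emeasure_eq_measure)
        then show "integrable (\<kappa> m (others n m (fst w))) (\<lambda>y. 1 - indicat_real {y. q j (answer w) y} y)"
          "K.expectation (\<lambda>y. 1 - indicat_real {y. q j (answer w) y} y) = 1 - K.prob {y. q j (answer w) y}"
          using K.prob_space by (simp_all add: Ksp)
      qed
      have "(\<integral>y. F (fst w) (answer w) y \<partial>\<kappa> m (others n m (fst w)))
          = (\<Sum>j\<in>J. p j (fst w) (answer w) * (1 - K.prob {y. q j (answer w) y}))"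
        unfolding F_def * using int by (simp add: Bochner_Integration.integral_sum)
      moreover have "\<dots> = F (fst w) (answer w) (fst w m) + A m w"
        unfolding F_def A_def sum.distrib[symmetric] by (intro sum.cong) (auto simp: algebra_simps)
      moreover have "(\<Sum>j\<in>J. p j (fst w) (answer w) * (1 - K.prob {y. q j (answer w) y})) \<le> W w"
        unfolding W_def using p0 by (intro sum_mono mult_left_le) auto
      ultimately show ?thesis by simp
    qed
    note res = resampling_integral_le[OF m F F01 Fst]
    define g where "g = (\<integral>w. \<integral>y. F (fst w) (answer w) y \<partial>\<kappa> m (others n m (fst w)) \<partial>(\<mu> \<Otimes>\<^sub>M G))"
    define d where "d = (\<integral>w. F (fst w) (answer w) (fst w m) \<partial>(\<mu> \<Otimes>\<^sub>M G))"
    have "(\<integral>w. A m w \<partial>(\<mu> \<Otimes>\<^sub>M G)) = g - d"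
    proof -
      have eq: "F (fst w) (answer w) (fst w m) = (\<integral>y. F (fst w) (answer w) y \<partial>\<kappa> m (others n m (fst w))) - A m w"
        if "w \<in> space (\<mu> \<Otimes>\<^sub>M G)" for w using inner[OF that] by simp
      have "d = (\<integral>w. (\<integral>y. F (fst w) (answer w) y \<partial>\<kappa> m (others n m (fst w))) - A m w \<partial>(\<mu> \<Otimes>\<^sub>M G))"
        unfolding d_def by (intro Bochner_Integration.integral_cong eq refl)
      also have "\<dots> = g - (\<integral>w. A m w \<partial>(\<mu> \<Otimes>\<^sub>M G))"
        unfolding g_def by (intro Bochner_Integration.integral_diff res(1) Aint m)
      finally show ?thesis by simp
    qed
    moreover have gd: "g \<le> exp e * d + \<delta>" unfolding g_def d_def e_def by (rule res(2))
    moreover have g0: "g \<ge> 0" unfolding g_def using F01 by (intro Bochner_Integration.integral_nonneg) auto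
    moreover have "g \<le> (\<integral>w. W w \<partial>(\<mu> \<Otimes>\<^sub>M G))"
      unfolding g_def by (intro integral_mono res(1) Wint conjunct2[OF inner])
    \<comment> \<open>Solving for \<open>d\<close> first puts the factor 1 - exp (- e) \<le> e in
      front of \<open>g\<close>, which is at most the integral of \<open>W\<close>.\<close>
    moreover have "g - d \<le> e * g + \<delta>"
    proof -
      have "exp (- e) * (g - \<delta>) \<le> exp (- e) * (exp e * d)" using gd by (intro mult_left_mono) auto
      then have "exp (- e) * (g - \<delta>) \<le> d" by (simp add: mult.assoc[symmetric] flip: exp_add)
      then have "g - d \<le> (1 - exp (- e)) * g + exp (- e) * \<delta>" by (simp add: algebra_simps)
      also have "\<dots> \<le> e * g + 1 * \<delta>"
        using exp_ge_add_one_self[of "- e"] g0 e \<delta> by (intro add_mono mult_right_mono) auto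
      finally show ?thesis by simp
    qed
    ultimately show ?thesis using mult_left_mono[OF _ e] by fastforce
  qed
  have dev: "\<bar>deviation (q j) S z\<bar> \<le> 1" for j S z
  proof -
    have "\<bar>\<Sum>m<n. of_bool (q j z (S m)) - measure (marginal \<mu> m) {y. q j z y}\<bar> \<le> (\<Sum>m<n. 1)"
    proof (rule order_trans[OF sum_abs], rule sum_mono)
      fix m assume "m \<in> {..<n}"
      then interpret K: prob_space "marginal \<mu> m" using prob_marginal by auto
      show "\<bar>of_bool (q j z (S m)) - measure (marginal \<mu> m) {y. q j z y}\<bar> \<le> 1"
        using K.prob_le_1[of "{y. q j z y}"] measure_nonneg[of "marginal \<mu> m" "{y. q j z y}"]
        by (auto simp: of_bool_def)
    qed
    then show ?thesis using n by (simp add: deviation_def abs_divide)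
  qed
  have Bint: "integrable (\<mu> \<Otimes>\<^sub>M G) B"
    unfolding B_def
  proof (intro Bochner_Integration.integrable_sum bounded[of _ _ "1 + \<bar>\<epsilon> + \<eta> + \<psi>\<bar>"])
    fix j assume j: "j \<in> J"
    show "(\<lambda>w. deviation (q j) (fst w) (answer w) - (\<epsilon> + \<eta> + \<psi>)) \<in> borel_measurable (\<mu> \<Otimes>\<^sub>M G)"
      using measurable_compose[OF pair measurable_deviation[OF j]] by simp
    show "\<bar>deviation (q j) (fst w) (answer w) - (\<epsilon> + \<eta> + \<psi>)\<bar> \<le> 1 + \<bar>\<epsilon> + \<eta> + \<psi>\<bar>" for w
      using dev[of j "fst w" "answer w"] by linarith
  qed
  \<comment> \<open>Marginals are exchanged for conditional laws inside the integral, at the very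
    dataset on which the selection depends; the cost averaged over the coordinates is at most \<psi>
    there.\<close>
  have BA: "B w \<le> (\<Sum>m<n. A m w) / real n - e * W w" if w: "w \<in> space (\<mu> \<Otimes>\<^sub>M G)" for w
  proof -
    define a where "a = (\<lambda>j m. of_bool (q j (answer w) (fst w m)) - measure (\<kappa> m (others n m (fst w))) {y. q j (answer w) y})"
    have "deviation (q j) (fst w) (answer w) \<le> (\<Sum>m<n. a j m) / real n + \<psi>" if j: "j \<in> J" for j
    proof -
      have "(\<Sum>m<n. of_bool (q j (answer w) (fst w m)) - measure (marginal \<mu> m) {y. q j (answer w) y})
          \<le> (\<Sum>m<n. a j m + tv_dist (marginal \<mu> m) (\<kappa> m (others n m (fst w))))"
      proof (rule sum_mono)
        fix m assume "m \<in> {..<n}"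
        then have m: "m < n" by simp
        have "{y. q j (answer w) y} \<in> sets (marginal \<mu> m)"
          using query_sets[OF j sp(2)[OF w]] by (simp add: marginal_def)
        from tv_dist_ge[OF prob_marginal[OF m] kernel_prob(1)[OF m sp(1)[OF w]] this]
        show "of_bool (q j (answer w) (fst w m)) - measure (marginal \<mu> m) {y. q j (answer w) y}
            \<le> a j m + tv_dist (marginal \<mu> m) (\<kappa> m (others n m (fst w)))"
          by (simp add: a_def)
      qed
      also have "\<dots> \<le> (\<Sum>m<n. a j m) + \<psi> * real n"
        using gibbs[OF sp(1)[OF w]] by (simp add: sum.distrib)
      finally show ?thesis using n by (simp add: deviation_def field_simps)
    qed
    then have "B w \<le> (\<Sum>j\<in>J. p j (fst w) (answer w) * ((\<Sum>m<n. a j m) / real n - e))"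
      unfolding B_def e_def using p0 by (intro sum_mono mult_left_mono) (auto simp: algebra_simps)
    also have "\<dots> = (\<Sum>j\<in>J. \<Sum>m<n. p j (fst w) (answer w) * a j m) / real n - e * W w"
      by (simp add: W_def right_diff_distrib sum_subtractf sum_distrib_left sum_divide_distrib mult.commute)
    also have "(\<Sum>j\<in>J. \<Sum>m<n. p j (fst w) (answer w) * a j m) = (\<Sum>m<n. A m w)"
      unfolding A_def a_def by (rule sum.swap)
    finally show ?thesis .
  qed
  show "integrable (\<mu> \<Otimes>\<^sub>M G) (\<lambda>w. \<Sum>j\<in>J. p j (fst w) (answer w) * (deviation (q j) (fst w) (answer w) - (\<epsilon> + \<eta> + \<psi>)))"
    using Bint by (simp add: B_def)
  have Sint: "integrable (\<mu> \<Otimes>\<^sub>M G) (\<lambda>w. \<Sum>m<n. A m w)"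
    using Aint by (intro Bochner_Integration.integrable_sum) auto
  have "(\<integral>w. B w \<partial>(\<mu> \<Otimes>\<^sub>M G)) \<le> (\<integral>w. (\<Sum>m<n. A m w) / real n - e * W w \<partial>(\<mu> \<Otimes>\<^sub>M G))"
    using Bint Sint Wint by (intro integral_mono BA Bochner_Integration.integrable_diff) auto
  also have "\<dots> = (\<Sum>m<n. \<integral>w. A m w \<partial>(\<mu> \<Otimes>\<^sub>M G)) / real n - e * (\<integral>w. W w \<partial>(\<mu> \<Otimes>\<^sub>M G))"
    using Sint Wint Aint by (subst Bochner_Integration.integral_diff) (auto simp: Bochner_Integration.integral_sum)
  \<comment> \<open>The n summands \<delta> are divided by n, and the bias cancels against the term
    subtracted with \<open>W\<close>.\<close>
  also have "\<dots> \<le> (\<Sum>m<n. e * (\<integral>w. W w \<partial>(\<mu> \<Otimes>\<^sub>M G)) + \<delta>) / real n - e * (\<integral>w. W w \<partial>(\<mu> \<Otimes>\<^sub>M G))"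
    using A by (intro diff_right_mono divide_right_mono sum_mono) auto
  also have "\<dots> = \<delta>" using n by simp
  finally show "(\<integral>w. (\<Sum>j\<in>J. p j (fst w) (answer w) * (deviation (q j) (fst w) (answer w) - (\<epsilon> + \<eta> + \<psi>))) \<partial>(\<mu> \<Otimes>\<^sub>M G)) \<le> \<delta>"
    by (simp add: B_def)
qed

end

text \<open>With negated queries among the options, a one-sided tail bound controls the absolute
  error.\<close>

lemma deviation_not:
  assumes "{y. q z y} \<in> sets borel"
  shows "deviation (\<lambda>z y. \<not> q z y) S z = - deviation q S z"
proof -
  have "of_bool (\<not> q z (S m)) - measure (marginal \<mu> m) {y. \<not> q z y}
      = - (of_bool (q z (S m)) - measure (marginal \<mu> m) {y. q z y})" if m: "m < n" for m
  proof -
    interpret X: prob_space "marginal \<mu> m" by (rule prob_marginal[OF m])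
    have "X.prob (space (marginal \<mu> m) - {y. q z y}) = 1 - X.prob {y. q z y}"
      using assms by (intro X.prob_compl) (simp add: marginal_def)
    moreover have "space (marginal \<mu> m) - {y. q z y} = {y. \<not> q z y}"
      by (auto simp: marginal_def)
    ultimately show ?thesis by (simp add: of_bool_def)
  qed
  then have "(\<Sum>m<n. of_bool (\<not> q z (S m)) - measure (marginal \<mu> m) {y. \<not> q z y})
      = (\<Sum>m<n. - (of_bool (q z (S m)) - measure (marginal \<mu> m) {y. q z y}))"
    by (intro sum.cong) auto
  then show ?thesis unfolding deviation_def by (simp only: sum_negf minus_divide_left)
qed

lemma deviation_upd:
  assumes "m < n"
  shows "\<bar>deviation q S z - deviation q (S(m := x)) z\<bar> \<le> 1 / real n"
proof -
  have "deviation q S z - deviation q (S(m := x)) z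
      = (\<Sum>i<n. of_bool (q z (S i)) - of_bool (q z ((S(m := x)) i))) / real n"
    by (simp add: deviation_def sum_subtractf diff_divide_distrib)
  also have "(\<Sum>i<n. of_bool (q z (S i)) - of_bool (q z ((S(m := x)) i)))
      = (\<Sum>i<n. if i = m then of_bool (q z (S m)) - of_bool (q z x) else (0 :: real))"
    by (intro sum.cong) auto
  also have "\<dots> = of_bool (q z (S m)) - of_bool (q z x)" using assms by simp
  finally have "\<bar>deviation q S z - deviation q (S(m := x)) z\<bar> = \<bar>of_bool (q z (S m)) - of_bool (q z x)\<bar> / real n"
    by (simp only: abs_divide abs_of_nat)
  also have "\<dots> \<le> 1 / real n" by (intro divide_right_mono) auto
  finally show ?thesis .
qed

lemma deviation_tail:
  fixes J :: "'j set" and q :: "'j \<Rightarrow> 'o \<Rightarrow> 'x \<Rightarrow> bool"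
  assumes J: "finite J" "card J \<ge> 2" and n: "n > 0"
    and q: "\<And>j. j \<in> J \<Longrightarrow> Measurable.pred (Y \<Otimes>\<^sub>M borel) (\<lambda>(z, x). q j z x)"
    and "0 < \<delta>" "\<delta> \<le> \<epsilon>" and large: "ln (real (card J) * \<epsilon> / \<delta>) \<le> real n * \<epsilon>\<^sup>2"
  defines "bad \<equiv> {w \<in> space (\<mu> \<Otimes>\<^sub>M G). \<exists>j\<in>J. deviation (q j) (fst w) (answer w) > 10 * \<epsilon> + \<psi>}"
  shows "bad \<in> sets (\<mu> \<Otimes>\<^sub>M G)" and "measure (\<mu> \<Otimes>\<^sub>M G) bad \<le> \<delta> / \<epsilon>"
proof -
  define c where "c = real n * \<epsilon>"
  have c: "c > 0" using n \<epsilon> by (simp add: c_def)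
  \<comment> \<open>This is the bias \<epsilon> + \<eta> + \<psi> of \<open>selection_bound\<close>
    at \<eta> = 2 * \<epsilon>. The distance to the threshold 10 * \<epsilon> + \<psi> is the 7 *
    \<epsilon> of \<open>softmax_pointwise\<close>.\<close>
  define a where "a = 3 * \<epsilon> + \<psi>"
  define u where "u = (\<lambda>S z j. deviation (q j) S z - a)"
  define W where "W = (\<lambda>S z. exp (2 * c * \<epsilon>) + (\<Sum>j\<in>J. exp (c * u S z j)))"
  define p where "p = (\<lambda>j S z. exp (c * u S z j) / W S z)"
  have W: "W S z > 0" for S z unfolding W_def by (intro add_pos_nonneg sum_nonneg) auto
  have dev [measurable]: "(\<lambda>w. deviation (q j) (fst w) (snd w)) \<in> borel_measurable (data_space n \<Otimes>\<^sub>M Y)"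
    if "j \<in> J" for j by (rule measurable_deviation[OF J(1) q that])
  have "(\<lambda>w. exp (c * u (fst w) (snd w) j)) \<in> borel_measurable (data_space n \<Otimes>\<^sub>M Y)" if "j \<in> J" for j
    unfolding u_def using dev[OF that] by measurable
  then have pm: "(\<lambda>w. p j (fst w) (snd w)) \<in> borel_measurable (data_space n \<Otimes>\<^sub>M Y)" if "j \<in> J" for j
    unfolding p_def W_def using that by (intro borel_measurable_divide borel_measurable_add borel_measurable_sum) auto
  have p0: "0 \<le> p j S z" for j S z using W[of S z] by (simp add: p_def)
  have p1: "(\<Sum>j\<in>J. p j S z) \<le> 1" for S z
    using W[of S z] by (simp add: p_def sum_divide_distrib[symmetric] field_simps) (simp add: W_def)
  have stable: "p j S z \<le> exp (2 * \<epsilon>) * p j (S(m := x)) z" if "j \<in> J" "m < n" for j S z m x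
    unfolding p_def W_def
  proof (rule softmax_stable[OF J(1) that(1)])
    fix i
    have "\<bar>c * u S z i - c * u (S(m := x)) z i\<bar> = c * \<bar>deviation (q i) S z - deviation (q i) (S(m := x)) z\<bar>"
      using c by (simp add: u_def abs_mult flip: right_diff_distrib)
    also have "\<dots> \<le> c * (1 / real n)" using c deviation_upd[OF that(2)] by (intro mult_left_mono) auto
    also have "\<dots> = \<epsilon>" using n by (simp add: c_def)
    finally show "\<bar>c * u S z i - c * u (S(m := x)) z i\<bar> \<le> \<epsilon>" .
  qed simp
  have pair: "(\<lambda>w. (fst w, answer w)) \<in> \<mu> \<Otimes>\<^sub>M G \<rightarrow>\<^sub>M data_space n \<Otimes>\<^sub>M Y"
    by (intro measurable_Pair measurable_answer) measurable
  have devP: "(\<lambda>w. deviation (q j) (fst w) (answer w)) \<in> borel_measurable (\<mu> \<Otimes>\<^sub>M G)" if "j \<in> J" for j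
    using measurable_compose[OF pair dev[OF that]] by simp
  show bad: "bad \<in> sets (\<mu> \<Otimes>\<^sub>M G)"
    unfolding bad_def
    by (intro sets.sets_Collect_finite_Ex J(1) borel_measurable_less[OF borel_measurable_const devP])
  define B where "B = (\<lambda>w. \<Sum>j\<in>J. p j (fst w) (answer w) * u (fst w) (answer w) j)"
  have B: "integrable (\<mu> \<Otimes>\<^sub>M G) B" "(\<integral>w. B w \<partial>(\<mu> \<Otimes>\<^sub>M G)) \<le> \<delta>"
    using selection_bound[OF J(1) q n, where \<eta> = "2 * \<epsilon>" and p = p] pm p0 p1 stable \<epsilon>
    by (simp_all add: B_def u_def a_def)
  have lnc: "ln (real (card J) * \<epsilon> / \<delta>) \<le> c * \<epsilon>" using large by (simp add: c_def power2_eq_square)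
  have low: "2 * \<epsilon> * indicator bad w - \<delta> \<le> B w" for w
  proof (cases "w \<in> bad")
    case True
    then obtain j where "j \<in> J" "10 * \<epsilon> + \<psi> < deviation (q j) (fst w) (answer w)" by (auto simp: bad_def)
    then have "\<exists>j\<in>J. u (fst w) (answer w) j > 7 * \<epsilon>" by (intro bexI[of _ j]) (simp_all add: u_def a_def)
    from softmax_pointwise(2)[OF J \<open>0 < \<delta>\<close> \<open>\<delta> \<le> \<epsilon>\<close> c lnc this] True show ?thesis
      by (simp add: B_def p_def W_def)
  next
    case False
    with softmax_pointwise(1)[OF J \<open>0 < \<delta>\<close> \<open>\<delta> \<le> \<epsilon>\<close> c lnc, of "u (fst w) (answer w)"] show ?thesis
      by (simp add: B_def p_def W_def)
  qed
  have ind: "integrable (\<mu> \<Otimes>\<^sub>M G) (indicat_real bad)"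
    using bad by (intro integrable_real_indicator) (auto simp: P.emeasure_eq_measure)
  have "2 * \<epsilon> * measure (\<mu> \<Otimes>\<^sub>M G) bad - \<delta> = (\<integral>w. 2 * \<epsilon> * indicator bad w - \<delta> \<partial>(\<mu> \<Otimes>\<^sub>M G))"
    using ind bad by (simp add: P.prob_space)
  also have "\<dots> \<le> (\<integral>w. B w \<partial>(\<mu> \<Otimes>\<^sub>M G))"
    using ind B(1) low by (intro integral_mono) auto
  finally show "measure (\<mu> \<Otimes>\<^sub>M G) bad \<le> \<delta> / \<epsilon>"
    using B(2) \<epsilon> by (simp add: field_simps)
qed

end

section \<open>The interactive game\<close>

lemma length_play [simp]: "length (play k f g) = k"
  by (induction k) (simp_all add: Let_def)

text \<open>Later rounds only append to the play, so its first i answers are those that the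
  adversary saw when asking query \<open>i\<close>.\<close>

lemma play_query:
  "i < k \<Longrightarrow> fst (play k f g ! i) = g (map (\<lambda>j. snd (play k f g ! j)) [0..<i])"
proof (induction k)
  case (Suc k)
  have *: "play (Suc k) f g ! j = play k f g ! j" if "j < k" for j
    using that by (simp add: Let_def nth_append)
  show ?case
  proof (cases "i < k")
    case True
    have "map (\<lambda>j. snd (play (Suc k) f g ! j)) [0..<i] = map (\<lambda>j. snd (play k f g ! j)) [0..<i]"
      using True * by (intro map_cong) auto
    with Suc.IH[OF True] *[OF True] show ?thesis by metis
  next
    case False
    with Suc.prems have [simp]: "i = k" by simp
    have "map (\<lambda>j. snd (play (Suc k) f g ! j)) [0..<k] = map (\<lambda>j. snd (play k f g ! j)) [0..<k]"
      using * by (intro map_cong) auto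
    also have "\<dots> = map snd (play k f g)"
      by (rule nth_equalityI) auto
    finally have "map (\<lambda>j. snd (play (Suc k) f g ! j)) [0..<k] = map snd (play k f g)" .
    then show ?thesis by (simp add: Let_def nth_append del: play.simps) (simp add: Let_def nth_append)
  qed
qed simp

lemma measure_pair_return:
  assumes "prob_space M" "A \<in> sets M"
  shows "measure (M \<Otimes>\<^sub>M return borel (r :: real)) (A \<times> UNIV) = measure M A"
proof -
  interpret r: prob_space "return borel r" by (rule prob_space_return) simp
  have "emeasure (M \<Otimes>\<^sub>M return borel r) (A \<times> UNIV) = emeasure M A * emeasure (return borel r) UNIV"
    using assms by (intro r.emeasure_pair_measure_Times) auto
  then show ?thesis by (simp add: measure_def)
qed

lemma (in pair_prob_space) measure_fst:
  assumes A: "A \<in> sets (M1 \<Otimes>\<^sub>M M2)"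
  shows "integrable M1 (\<lambda>x. measure M2 {y \<in> space M2. (x, y) \<in> A})"
    and "measure (M1 \<Otimes>\<^sub>M M2) A = (\<integral>x. measure M2 {y \<in> space M2. (x, y) \<in> A} \<partial>M1)"
proof -
  have int: "integrable (M1 \<Otimes>\<^sub>M M2) (indicat_real A)"
    using A by (intro integrable_real_indicator) (auto simp: P.emeasure_eq_measure)
  have inner: "(\<integral>y. indicat_real A (x, y) \<partial>M2) = measure M2 {y \<in> space M2. (x, y) \<in> A}" for x
  proof -
    have "(\<integral>y. indicat_real A (x, y) \<partial>M2) = (\<integral>y. indicat_real {y \<in> space M2. (x, y) \<in> A} y \<partial>M2)"
      by (intro Bochner_Integration.integral_cong) (auto simp: indicator_def)
    also have "\<dots> = measure M2 ({y \<in> space M2. (x, y) \<in> A} \<inter> space M2)"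
      by simp
    finally show ?thesis by (simp add: Int_absorb2 subset_eq)
  qed
  show "integrable M1 (\<lambda>x. measure M2 {y \<in> space M2. (x, y) \<in> A})"
    using integrable_fst'[OF int] by (simp add: inner)
  show "measure (M1 \<Otimes>\<^sub>M M2) A = (\<integral>x. measure M2 {y \<in> space M2. (x, y) \<in> A} \<partial>M1)"
    using integral_fst'[OF int] sets.sets_into_space[OF A] by (simp add: inner Int_absorb2)
qed

section \<open>Adversary's coins and replies in place of the transcript\<close>

definition replies :: "nat \<Rightarrow> (nat \<Rightarrow> 'x query \<times> real) \<Rightarrow> nat \<Rightarrow> real" where
  "replies k t = (\<lambda>i\<in>{..<k}. snd (t i))"

definition fix_coins :: "'x adversary \<Rightarrow> real \<Rightarrow> 'x adversary" where
  "fix_coins A r = \<lparr>adv_coins = return borel r, ask = (\<lambda>_. ask A r)\<rparr>"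

lemma transcript_query:
  assumes "i < k"
  shows "fst (transcript k M A S c i) = ask A (snd c) (map (replies k (transcript k M A S c)) [0..<i])"
proof -
  obtain w r where c: "c = (w, r)" by (cases c)
  define t where "t = transcript k M A S c"
  define p where "p = play k (respond M S w) (ask A r)"
  have t: "t j = p ! j" if "j < k" for j
    using that by (simp add: t_def p_def c transcript_def)
  have "map (replies k t) [0..<i] = map (\<lambda>j. snd (p ! j)) [0..<i]"
    using assms by (intro map_cong) (auto simp: replies_def t)
  moreover have "fst (p ! i) = ask A r (map (\<lambda>j. snd (p ! j)) [0..<i])"
    unfolding p_def by (rule play_query[OF assms])
  ultimately have "fst (t i) = ask A r (map (replies k t) [0..<i])" by (simp only: t[OF assms])
  then show ?thesis by (simp only: t_def c snd_conv)
qed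

lemma transcript_fix_coins: "transcript k M (fix_coins A r) S (w, r') = transcript k M A S (w, r)"
  by (simp add: transcript_def fix_coins_def)

lemma measurable_replies: "replies k \<in> transcript_space k \<rightarrow>\<^sub>M PiM {..<k} (\<lambda>_. borel)"
  unfolding replies_def transcript_space_def
proof (rule measurable_restrict)
  fix i assume "i \<in> {..<k}"
  from measurable_component_singleton[OF this]
  show "(\<lambda>t. snd (t i)) \<in> PiM {..<k} (\<lambda>_. PiM UNIV (\<lambda>_. count_space UNIV) \<Otimes>\<^sub>M borel) \<rightarrow>\<^sub>M borel"
    by (rule measurable_compose[OF _ measurable_snd])
qed

lemma adversary_wf_fix_coins:
  fixes A :: "'x::metric_space adversary"
  assumes A: "adversary_wf k A"
  shows "adversary_wf k (fix_coins A r)"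
proof -
  have sets: "sets (adv_coins A) = sets borel" using A by (simp add: adversary_wf_def)
  have "(\<lambda>((r', a), x). ask A r (map a [0..<i]) x)
      \<in> (return borel r \<Otimes>\<^sub>M PiM {..<i} (\<lambda>_. borel)) \<Otimes>\<^sub>M (borel :: 'x measure) \<rightarrow>\<^sub>M count_space UNIV" if i: "i < k" for i
  proof -
    have "(\<lambda>((r, a), x). ask A r (map a [0..<i]) x)
        \<in> (adv_coins A \<Otimes>\<^sub>M PiM {..<i} (\<lambda>_. borel)) \<Otimes>\<^sub>M borel \<rightarrow>\<^sub>M count_space UNIV"
      using A i by (simp add: adversary_wf_def)
    then have 1: "(\<lambda>z. ask A (fst (fst z)) (map (snd (fst z)) [0..<i]) (snd z))
        \<in> (adv_coins A \<Otimes>\<^sub>M PiM {..<i} (\<lambda>_. borel)) \<Otimes>\<^sub>M borel \<rightarrow>\<^sub>M count_space UNIV"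
      by (simp add: split_def)
    have "(\<lambda>z. ((r, snd (fst z)), snd z)) \<in> (return borel r \<Otimes>\<^sub>M PiM {..<i} (\<lambda>_. borel)) \<Otimes>\<^sub>M (borel :: 'x measure)
        \<rightarrow>\<^sub>M (adv_coins A \<Otimes>\<^sub>M PiM {..<i} (\<lambda>_. borel)) \<Otimes>\<^sub>M borel"
      using sets_eq_imp_space_eq[OF sets]
      by (intro measurable_Pair measurable_const measurable_compose[OF measurable_fst measurable_snd] measurable_snd) simp
    from measurable_compose[OF this 1] show ?thesis by (simp add: split_def)
  qed
  then show ?thesis by (simp add: adversary_wf_def fix_coins_def prob_space_return)
qed

text \<open>\<open>adversary_wf\<close> speaks of tuples of exactly \<open>i\<close> answers,
  whereas the observation holds all \<open>k\<close>. Restricting to the first \<open>i\<close>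
  bridges this and is invisible to the list over \<open>[0..<i]\<close>.\<close>

lemma measurable_ask:
  fixes A :: "'x::metric_space adversary"
  assumes A: "adversary_wf k A" and i: "i < k"
  shows "Measurable.pred ((borel \<Otimes>\<^sub>M PiM {..<k} (\<lambda>_. borel)) \<Otimes>\<^sub>M borel)
    (\<lambda>(z, x). ask A (fst z) (map (snd z) [0..<i]) x)"
proof -
  have sets: "sets (adv_coins A) = sets borel" using A by (simp add: adversary_wf_def)
  have "(\<lambda>((r, a), x). ask A r (map a [0..<i]) x)
      \<in> (adv_coins A \<Otimes>\<^sub>M PiM {..<i} (\<lambda>_. borel)) \<Otimes>\<^sub>M borel \<rightarrow>\<^sub>M count_space UNIV"
    using A i by (simp add: adversary_wf_def)
  then have 1: "(\<lambda>z. ask A (fst (fst z)) (map (snd (fst z)) [0..<i]) (snd z))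
      \<in> (adv_coins A \<Otimes>\<^sub>M PiM {..<i} (\<lambda>_. borel)) \<Otimes>\<^sub>M borel \<rightarrow>\<^sub>M count_space UNIV"
    by (simp add: split_def)
  have "(\<lambda>z. ((fst (fst z), restrict (snd (fst z)) {..<i}), snd z))
      \<in> (borel \<Otimes>\<^sub>M PiM {..<k} (\<lambda>_. borel)) \<Otimes>\<^sub>M (borel :: 'x measure)
      \<rightarrow>\<^sub>M (adv_coins A \<Otimes>\<^sub>M PiM {..<i} (\<lambda>_. borel)) \<Otimes>\<^sub>M borel"
    using i measurable_compose[OF measurable_fst measurable_fst]
    by (intro measurable_Pair measurable_snd measurable_compose[OF measurable_compose[OF measurable_fst measurable_snd] measurable_restrict_subset])
       (auto simp: measurable_cong_sets[OF refl sets])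
  from measurable_compose[OF this 1]
  have "(\<lambda>z. ask A (fst (fst z)) (map (restrict (snd (fst z)) {..<i}) [0..<i]) (snd z))
      \<in> (borel \<Otimes>\<^sub>M PiM {..<k} (\<lambda>_. borel)) \<Otimes>\<^sub>M borel \<rightarrow>\<^sub>M count_space UNIV" by simp
  moreover have "map (restrict a {..<i}) [0..<i] = map a [0..<i]" for a :: "nat \<Rightarrow> real"
    by (rule map_cong) auto
  ultimately show ?thesis by (simp add: split_def)
qed

text \<open>For uncountable \<open>'x\<close>, evaluating a query at a point is not jointly
  measurable for the sigma-algebra generated by evaluations. Queries are therefore not read off the
  transcript but recomputed by \<open>ask\<close> from the coins and the replies, where joint
  measurability is part of \<open>adversary_wf\<close>.\<close>

definition observation ::
  "nat \<Rightarrow> ('x, 'w) mechanism \<Rightarrow> 'x adversary \<Rightarrow> (nat \<Rightarrow> 'x) \<Rightarrow> 'w \<times> real \<Rightarrow> real \<times> (nat \<Rightarrow> real)" where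
  "observation k M A S c = (snd c, replies k (transcript k M A S c))"

abbreviation observation_space :: "nat \<Rightarrow> (real \<times> (nat \<Rightarrow> real)) measure" where
  "observation_space k \<equiv> borel \<Otimes>\<^sub>M PiM {..<k} (\<lambda>_. borel)"

lemma measurable_observation:
  fixes M :: "('x::metric_space, 'w) mechanism"
  assumes M: "mechanism_wf n k M" and A: "adversary_wf k A"
  shows "(\<lambda>z. observation k M A (fst z) (snd z)) \<in> data_space n \<Otimes>\<^sub>M game_coins M A \<rightarrow>\<^sub>M observation_space k"
  unfolding observation_def
proof (rule measurable_Pair)
  have sets: "sets (adv_coins A) = sets borel" using A by (simp add: adversary_wf_def)
  show "(\<lambda>z. snd (snd z)) \<in> data_space n \<Otimes>\<^sub>M game_coins M A \<rightarrow>\<^sub>M borel"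
    using measurable_compose[OF measurable_snd measurable_snd, of "data_space n" "mech_coins M" "adv_coins A"]
    unfolding measurable_cong_sets[OF refl sets] by simp
  have "(\<lambda>z. transcript k M A (fst z) (snd z)) \<in> data_space n \<Otimes>\<^sub>M game_coins M A \<rightarrow>\<^sub>M transcript_space k"
    using M A by (simp add: mechanism_wf_def split_def)
  then show "(\<lambda>z. replies k (transcript k M A (fst z) (snd z))) \<in> data_space n \<Otimes>\<^sub>M game_coins M A \<rightarrow>\<^sub>M PiM {..<k} (\<lambda>_. borel)"
    by (rule measurable_compose[OF _ measurable_replies])
qed

text \<open>Privacy of the transcript says nothing about the adversary's coins, so it is applied to the
  adversaries with fixed coins and then averaged.\<close>

lemma private_observation:
  fixes M :: "('x::metric_space, 'w) mechanism"
  assumes M: "mechanism_wf n k M" and A: "adversary_wf k A" and dp: "private_mechanism n k \<epsilon> \<delta> M"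
    and S: "S \<in> space (data_space n)" "S' \<in> space (data_space n)" and nb: "neighbours n S S'"
    and E: "E \<in> sets (observation_space k)"
  shows "measure (game_coins M A) {c \<in> space (game_coins M A). observation k M A S c \<in> E}
    \<le> exp \<epsilon> * measure (game_coins M A) {c \<in> space (game_coins M A). observation k M A S' c \<in> E} + \<delta>"
proof -
  interpret m: prob_space "mech_coins M" using M by (simp add: mechanism_wf_def)
  interpret r: prob_space "adv_coins A" using A by (simp add: adversary_wf_def)
  interpret P: pair_prob_space "adv_coins A" "mech_coins M" ..
  interpret Q: pair_prob_space "mech_coins M" "adv_coins A" ..
  have sets: "sets (adv_coins A) = sets borel" using A by (simp add: adversary_wf_def)
  have sp: "space (adv_coins A) = UNIV" using sets_eq_imp_space_eq[OF sets] by simp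
  define f where "f = (\<lambda>T r. measure (mech_coins M) {w \<in> space (mech_coins M). observation k M A T (w, r) \<in> E})"
  have avg: "integrable (adv_coins A) (f T)"
    "measure (game_coins M A) {c \<in> space (game_coins M A). observation k M A T c \<in> E} = (\<integral>r. f T r \<partial>adv_coins A)"
    if T: "T \<in> space (data_space n)" for T
  proof -
    have obs: "observation k M A T \<in> game_coins M A \<rightarrow>\<^sub>M observation_space k"
      using measurable_Pair2[OF measurable_observation[OF M A] T] by simp
    have X: "{c \<in> space (game_coins M A). observation k M A T c \<in> E} \<in> sets (game_coins M A)" (is "?X \<in> _")
      using measurable_sets[OF obs E] by (simp add: vimage_def Int_def conj_commute)
    \<comment> \<open>The factors are swapped so that the adversary's coins become the outer
      variable of the iterated integral.\<close>
    define Z where "Z = (\<lambda>(r, w). (w, r)) -` ?X \<inter> space (adv_coins A \<Otimes>\<^sub>M mech_coins M)"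
    have Z: "Z \<in> sets (adv_coins A \<Otimes>\<^sub>M mech_coins M)"
      unfolding Z_def by (rule measurable_sets[OF measurable_pair_swap' X])
    have "measure (game_coins M A) ?X = measure (distr (adv_coins A \<Otimes>\<^sub>M mech_coins M) (game_coins M A) (\<lambda>(r, w). (w, r))) ?X"
      using Q.distr_pair_swap by simp
    also have "\<dots> = measure (adv_coins A \<Otimes>\<^sub>M mech_coins M) Z"
      unfolding Z_def using X by (intro measure_distr measurable_pair_swap')
    finally have 1: "measure (game_coins M A) ?X = measure (adv_coins A \<Otimes>\<^sub>M mech_coins M) Z" .
    have "f T = (\<lambda>r. measure (mech_coins M) {w \<in> space (mech_coins M). (r, w) \<in> Z})"
      unfolding f_def Z_def by (intro ext arg_cong[where f = "measure _"]) (auto simp: space_pair_measure sp)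
    then show "integrable (adv_coins A) (f T)" "measure (game_coins M A) ?X = (\<integral>r. f T r \<partial>adv_coins A)"
      using P.measure_fst[OF Z] 1 by simp_all
  qed
  have fdp: "f S r \<le> exp \<epsilon> * f S' r + \<delta>" for r
  proof -
    \<comment> \<open>Once \<open>r\<close> is constant, an event about coins and replies is an
      event about the transcript alone.\<close>
    define E' where "E' = (\<lambda>t. (r, replies k t)) -` E \<inter> space (transcript_space k :: (nat \<Rightarrow> 'x query \<times> real) measure)"
    have E': "E' \<in> sets (transcript_space k)"
      unfolding E'_def by (rule measurable_sets[OF measurable_Pair[OF measurable_const measurable_replies] E]) simp
    note wf = adversary_wf_fix_coins[OF A, of r]
    have coins: "game_coins M (fix_coins A r) = mech_coins M \<Otimes>\<^sub>M return borel r" by (simp add: fix_coins_def)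
    have law: "measure (distr (game_coins M (fix_coins A r)) (transcript_space k) (transcript k M (fix_coins A r) T)) E' = f T r"
      if T: "T \<in> space (data_space n)" for T
    proof -
      have "(\<lambda>(S, c). transcript k M (fix_coins A r) S c) \<in> data_space n \<Otimes>\<^sub>M game_coins M (fix_coins A r) \<rightarrow>\<^sub>M transcript_space k"
        using M wf by (simp add: mechanism_wf_def)
      from measurable_Pair2[OF this T]
      have tr: "transcript k M (fix_coins A r) T \<in> game_coins M (fix_coins A r) \<rightarrow>\<^sub>M transcript_space k" by simp
      define B where "B = {w \<in> space (mech_coins M). observation k M A T (w, r) \<in> E}"
      have obs: "observation k M A T \<in> game_coins M A \<rightarrow>\<^sub>M observation_space k"
        using measurable_Pair2[OF measurable_observation[OF M A] T] by simp
      have "(\<lambda>w. observation k M A T (w, r)) \<in> mech_coins M \<rightarrow>\<^sub>M observation_space k"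
        by (rule measurable_Pair1[OF obs]) (simp add: sp)
      from measurable_sets[OF this E] have B: "B \<in> sets (mech_coins M)"
        by (simp add: B_def vimage_def Int_def conj_commute)
      have "measure (distr (game_coins M (fix_coins A r)) (transcript_space k) (transcript k M (fix_coins A r) T)) E'
          = measure (game_coins M (fix_coins A r)) (transcript k M (fix_coins A r) T -` E' \<inter> space (game_coins M (fix_coins A r)))"
        by (rule measure_distr[OF tr E'])
      also have "transcript k M (fix_coins A r) T -` E' \<inter> space (game_coins M (fix_coins A r)) = B \<times> UNIV"
      proof -
        have "transcript k M (fix_coins A r) T c \<in> E' \<longleftrightarrow> observation k M A T (fst c, r) \<in> E"
          if "c \<in> space (game_coins M (fix_coins A r))" for c
          using measurable_space[OF tr that]
          by (cases c) (simp add: E'_def observation_def transcript_fix_coins)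
        then show ?thesis by (auto simp: coins space_pair_measure B_def)
      qed
      also have "measure (game_coins M (fix_coins A r)) (B \<times> UNIV) = f T r"
        unfolding coins using measure_pair_return[OF m.prob_space_axioms B] by (simp add: f_def B_def)
      finally show ?thesis .
    qed
    have "differentially_private n \<epsilon> \<delta> (transcript_space k)
        (\<lambda>S. distr (game_coins M (fix_coins A r)) (transcript_space k) (transcript k M (fix_coins A r) S))"
      using dp wf by (simp add: private_mechanism_def)
    from this[unfolded differentially_private_def, rule_format, OF S nb E'] show ?thesis
      by (simp only: law S)
  qed
  have "(\<integral>r. f S r \<partial>adv_coins A) \<le> (\<integral>r. exp \<epsilon> * f S' r + \<delta> \<partial>adv_coins A)"
    using avg(1)[OF S(1)] avg(1)[OF S(2)] fdp by (intro integral_mono) auto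
  also have "\<dots> = exp \<epsilon> * (\<integral>r. f S' r \<partial>adv_coins A) + \<delta>"
    using avg(1)[OF S(2)] r.prob_space by simp
  finally show ?thesis using avg(2) S by simp
qed

section \<open>From deviations to statistical accuracy\<close>

lemma gibbs_dependenceE:
  fixes \<mu> :: "(nat \<Rightarrow> 'x::metric_space) measure"
  assumes \<mu>: "prob_space \<mu>" and sets: "sets \<mu> = sets (data_space n)" and n: "n > 0"
    and gibbs: "gibbs_dependence n \<psi> \<mu>"
  obtains \<kappa> where "\<And>m. m < n \<Longrightarrow> conditional_version n \<mu> m (\<kappa> m)"
    and "\<And>S. S \<in> space (data_space n) \<Longrightarrow> (\<Sum>i<n. tv_dist (marginal \<mu> i) (\<kappa> i (others n i S))) \<le> \<psi> * real n"
proof -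
  interpret prob_space \<mu> by fact
  from gibbs obtain \<kappa> where cv: "\<And>m. m < n \<Longrightarrow> conditional_version n \<mu> m (\<kappa> m)"
    and coeff: "gibbs_coefficient n \<mu> \<kappa> \<le> \<psi>"
    by (auto simp: gibbs_dependence_def)
  define h where "h S = (\<Sum>i<n. tv_dist (marginal \<mu> i) (\<kappa> i (others n i S))) / real n" for S
  have tv: "tv_dist (marginal \<mu> i) (\<kappa> i (others n i S)) \<le> 1" if "S \<in> space (data_space n)" "i < n" for S i
  proof (rule tv_dist_le_1)
    show "prob_space (marginal \<mu> i)"
      unfolding marginal_def using that by (intro prob_space_distr) (simp add: measurable_cong_sets[OF sets refl])
    show "prob_space (\<kappa> i (others n i S))"
      using conditional_version_kernel(2)[OF cv[OF that(2)] that(1)] .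
  qed
  have "h S \<le> 1" if "S \<in> space (data_space n)" for S
    using sum_mono[of "{..<n}" "\<lambda>i. tv_dist (marginal \<mu> i) (\<kappa> i (others n i S))" "\<lambda>_. 1"] tv[OF that] n
    by (simp add: h_def)
  \<comment> \<open>A real supremum bounds its members only if they are bounded above, which the
    bound 1 on total variation supplies.\<close>
  then have "bdd_above (h ` space (data_space n))" by (intro bdd_aboveI[of _ 1]) auto
  then have "h S \<le> \<psi>" if "S \<in> space (data_space n)" for S
    using cSUP_upper[OF that, of h] coeff unfolding gibbs_coefficient_def h_def by linarith
  then show ?thesis using n cv that[of \<kappa>] by (simp add: h_def field_simps)
qed

lemma query_mean_eq:
  fixes \<mu> :: "(nat \<Rightarrow> 'x::metric_space) measure"
  assumes \<mu>: "prob_space \<mu>" and sets: "sets \<mu> = sets (data_space n)" and q: "Collect q \<in> sets borel"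
  shows "query_mean n q \<mu> = (\<Sum>m<n. measure (marginal \<mu> m) {y. q y}) / real n"
proof -
  interpret prob_space \<mu> by fact
  have c: "(\<lambda>T. T m) \<in> \<mu> \<rightarrow>\<^sub>M borel" if "m < n" for m
    using that by (simp add: measurable_cong_sets[OF sets refl])
  have s: "{T \<in> space \<mu>. q (T m)} \<in> sets \<mu>" if "m < n" for m
    using measurable_sets[OF c[OF that] q] by (simp add: vimage_def Int_def conj_commute)
  have int: "integrable \<mu> (\<lambda>T. of_bool (q (T m)) :: real)" and e: "(\<integral>T. of_bool (q (T m)) \<partial>\<mu>) = measure (marginal \<mu> m) {y. q y}"
    if m: "m < n" for m
  proof -
    have eq: "of_bool (q (T m)) = indicat_real {T \<in> space \<mu>. q (T m)} T" if "T \<in> space \<mu>" for T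
      using that by (simp add: indicator_def)
    have "integrable \<mu> (indicat_real {T \<in> space \<mu>. q (T m)})"
      using s[OF m] by (intro integrable_real_indicator) (auto simp: emeasure_eq_measure)
    then show "integrable \<mu> (\<lambda>T. of_bool (q (T m)) :: real)"
      by (subst Bochner_Integration.integrable_cong[OF refl eq])
    have "(\<integral>T. of_bool (q (T m)) \<partial>\<mu>) = (\<integral>T. indicat_real {T \<in> space \<mu>. q (T m)} T \<partial>\<mu>)"
      by (intro Bochner_Integration.integral_cong refl eq)
    also have "\<dots> = prob {T \<in> space \<mu>. q (T m)}" using s[OF m] by simp
    also have "\<dots> = measure (marginal \<mu> m) {y. q y}"
      unfolding marginal_def using q by (subst measure_distr[OF c[OF m]]) (auto simp: vimage_def Int_def conj_commute)
    finally show "(\<integral>T. of_bool (q (T m)) \<partial>\<mu>) = measure (marginal \<mu> m) {y. q y}" .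
  qed
  have "query_mean n q \<mu> = (\<integral>T. (\<Sum>m<n. of_bool (q (T m))) \<partial>\<mu>) / real n"
    unfolding query_mean_def empirical_value_def by (rule Bochner_Integration.integral_divide_zero)
  also have "(\<integral>T. (\<Sum>m<n. of_bool (q (T m)) :: real) \<partial>\<mu>) = (\<Sum>m<n. \<integral>T. of_bool (q (T m)) \<partial>\<mu>)"
    using int by (intro Bochner_Integration.integral_sum) auto
  finally show ?thesis using e by simp
qed

text \<open>By the triangle inequality a statistical error comes from an empirical error above
  \<alpha> or from a query whose empirical value is far from its mean; these two events have
  probability at most \<beta> and \<delta> / \<epsilon>. The excluded cases \<open>k = 0\<close> and
  \<delta> > \<epsilon> are trivial.\<close>

lemma statistical_error_bound:
  fixes \<epsilon> \<delta> \<alpha> \<beta> \<psi> :: real and M :: "('x::metric_space, 'w) mechanism"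
  assumes \<epsilon>: "\<epsilon> > 0" and delta: "\<delta> > 0" "\<delta> \<le> \<epsilon>" and k: "k > 0" and \<psi>: "\<psi> \<ge> 0"
    and M: "mechanism_wf n k M" and dp: "private_mechanism n k \<epsilon> \<delta> M"
    and emp: "empirically_accurate n k \<alpha> \<beta> M"
    and large: "real n \<ge> ln (2 * real k * \<epsilon> / \<delta>) / \<epsilon>\<^sup>2"
    and \<mu>: "prob_space \<mu>" and sets: "sets \<mu> = sets (data_space n)" and gibbs: "gibbs_dependence n \<psi> \<mu>"
    and A: "adversary_wf k A"
  shows "measure (\<mu> \<Otimes>\<^sub>M game_coins M A)
      {(S, c) \<in> space (\<mu> \<Otimes>\<^sub>M game_coins M A).
         \<exists>i<k. \<bar>query_mean n (fst (transcript k M A S c i)) \<mu> - snd (transcript k M A S c i)\<bar> > \<alpha> + 10 * \<epsilon> + 2 * \<psi>}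
    \<le> \<beta> + \<delta> / \<epsilon>" (is "measure ?P ?err \<le> _")
proof -
  have ratio: "1 < 2 * real k * \<epsilon> / \<delta>"
  proof -
    have "\<delta> < 2 * \<epsilon>" using delta \<epsilon> by simp
    also have "\<dots> \<le> 2 * real k * \<epsilon>" using k \<epsilon> by simp
    finally show ?thesis using delta by simp
  qed
  have large': "ln (2 * real k * \<epsilon> / \<delta>) \<le> real n * \<epsilon>\<^sup>2" using large \<epsilon> by (simp add: pos_divide_le_eq)
  \<comment> \<open>The logarithm is strictly positive, so the sample size condition itself rules
    out an empty dataset.\<close>
  have n: "n > 0" using large' ln_gt_zero[OF ratio] by (cases n) auto
  from gibbs_dependenceE[OF \<mu> sets n gibbs] obtain \<kappa> where
    cv: "\<And>m. m < n \<Longrightarrow> conditional_version n \<mu> m (\<kappa> m)" and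
    tv: "\<And>S. S \<in> space (data_space n) \<Longrightarrow> (\<Sum>i<n. tv_dist (marginal \<mu> i) (\<kappa> i (others n i S))) \<le> \<psi> * real n"
    by blast
  have G: "prob_space (game_coins M A)"
  proof -
    interpret m: prob_space "mech_coins M" using M by (simp add: mechanism_wf_def)
    interpret r: prob_space "adv_coins A" using A by (simp add: adversary_wf_def)
    interpret P: pair_prob_space "mech_coins M" "adv_coins A" ..
    show ?thesis by unfold_locales
  qed
  interpret private_gibbs n \<mu> \<kappa> \<psi> "game_coins M A" "observation_space k" "observation k M A" \<epsilon> \<delta>
  proof (rule private_gibbs.intro)
    show "prob_space \<mu>" "prob_space (game_coins M A)" "\<epsilon> > 0" "\<delta> \<ge> 0"
      using \<mu> G \<epsilon> delta by simp_all
    show "conditional_version n \<mu> m (\<kappa> m)" if "m < n" for m by (rule cv[OF that])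
    show "(\<Sum>i<n. tv_dist (marginal \<mu> i) (\<kappa> i (others n i S))) \<le> \<psi> * real n"
      if "S \<in> space (data_space n)" for S by (rule tv[OF that])
    show "sets \<mu> = sets (data_space n)" by (rule sets)
    show "(\<lambda>z. observation k M A (fst z) (snd z)) \<in> data_space n \<Otimes>\<^sub>M game_coins M A \<rightarrow>\<^sub>M observation_space k"
      by (rule measurable_observation[OF M A])
    fix S :: "nat \<Rightarrow> 'x" and m :: nat and y :: 'x and E
    assume S: "S \<in> space (data_space n)" and m: "m < n" and E: "E \<in> sets (observation_space k)"
    show "measure (game_coins M A) {c \<in> space (game_coins M A). observation k M A S c \<in> E}
      \<le> exp \<epsilon> * measure (game_coins M A) {c \<in> space (game_coins M A). observation k M A (S(m := y)) c \<in> E} + \<delta>"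
    \<comment> \<open>Neighbours differ in exactly one entry, so rewriting the old value is not an
      instance of privacy; there exp \<epsilon> \<ge> 1 suffices.\<close>
    proof (cases "S m = y")
      case True
      then have eq: "S(m := y) = S" by auto
      have "1 * p \<le> exp \<epsilon> * p" if "p \<ge> 0" for p :: real using that \<epsilon> by (intro mult_right_mono) auto
      from this[OF measure_nonneg, of "game_coins M A" "{c \<in> space (game_coins M A). observation k M A S c \<in> E}"]
      show ?thesis unfolding eq using delta by linarith
    next
      case False
      have "{i \<in> {..<n}. S i \<noteq> (S(m := y)) i} = {m}" using False m by auto
      then have nb: "neighbours n S (S(m := y))" by (simp add: neighbours_def)
      have "S(m := y) \<in> space (data_space n)"
        using measurable_space[OF measurable_resample[OF m], of "(S, y)"] S by (simp add: space_pair_measure)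
      from private_observation[OF M A dp S this nb E] show ?thesis .
    qed
  qed
  \<comment> \<open>Every round contributes the query and its negation, chosen by comparing the
    query's value with the Boolean \<open>snd j\<close>. This is the factor 2 inside the
    logarithm.\<close>
  define J where "J = {..<k} \<times> (UNIV :: bool set)"
  define q where "q = (\<lambda>j z x. ask A (fst z) (map (snd z) [0..<fst j]) x = snd j)"
  have J: "finite J" "card J = 2 * k" by (simp_all add: J_def card_cartesian_product)
  have q: "Measurable.pred (observation_space k \<Otimes>\<^sub>M borel) (\<lambda>(z, x). q j z x)" if "j \<in> J" for j
  proof -
    have "fst j < k" using that by (auto simp: J_def)
    from measurable_ask[OF A this] show ?thesis by (cases "snd j") (simp_all add: q_def split_def)
  qed
  have cardJ: "card J \<ge> 2" using J(2) k by simp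
  have largeJ: "ln (real (card J) * \<epsilon> / \<delta>) \<le> real n * \<epsilon>\<^sup>2" using large' by (simp add: J(2))
  define gap where "gap = {w \<in> space ?P. \<exists>j\<in>J. deviation (q j) (fst w) (observation k M A (fst w) (snd w)) > 10 * \<epsilon> + \<psi>}"
  have gap: "gap \<in> sets ?P" "measure ?P gap \<le> \<delta> / \<epsilon>"
    unfolding gap_def by (rule deviation_tail[OF J(1) cardJ n q delta largeJ]; assumption)+
  define est where "est = {w \<in> space ?P. \<exists>i<k. \<bar>empirical_value n (fst (transcript k M A (fst w) (snd w) i)) (fst w)
      - snd (transcript k M A (fst w) (snd w) i)\<bar> > \<alpha>}"
  have query: "fst (transcript k M A S c i) x \<longleftrightarrow> q (i, True) (observation k M A S c) x" if "i < k" for S c i x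
    using transcript_query[OF that, of M A S c] by (simp add: q_def observation_def)
  have reply: "snd (transcript k M A S c i) = snd (observation k M A S c) i" if "i < k" for S c i
    using that by (simp add: observation_def replies_def)
  \<comment> \<open>Queries and replies are first rewritten in terms of the observation, from which
    they can be evaluated measurably at the entries of the dataset.\<close>
  have est_sets: "est \<in> sets ?P"
  proof -
    have emp_m: "(\<lambda>w. empirical_value n (fst (transcript k M A (fst w) (snd w) i)) (fst w)) \<in> borel_measurable ?P" if i: "i < k" for i
    proof -
      have ind: "(\<lambda>w. of_bool (q (i, True) (observation k M A (fst w) (snd w)) (fst w m)) :: real) \<in> borel_measurable ?P" if m: "m < n" for m
      proof -
        have "(\<lambda>w. fst w m) \<in> ?P \<rightarrow>\<^sub>M borel"
          by (rule measurable_compose[OF measurable_fst]) (use m in \<open>simp add: measurable_cong_sets[OF sets refl]\<close>)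
        then have "Measurable.pred ?P (\<lambda>w. q (i, True) (observation k M A (fst w) (snd w)) (fst w m))"
          using i by (intro measurable_query[OF J(1) q] measurable_answer) (auto simp: J_def)
        then show ?thesis by (rule measurable_compose) simp
      qed
      show ?thesis
        unfolding empirical_value_def query[OF i]
        by (intro borel_measurable_divide borel_measurable_sum borel_measurable_const ind) simp
    qed
    have reply_m: "(\<lambda>w. snd (transcript k M A (fst w) (snd w) i)) \<in> borel_measurable ?P" if i: "i < k" for i
      unfolding reply[OF i] using i
      by (intro measurable_compose[OF measurable_compose[OF measurable_answer measurable_snd] measurable_component_singleton]) auto
    have est_i: "{w \<in> space ?P. \<alpha> < \<bar>empirical_value n (fst (transcript k M A (fst w) (snd w) i)) (fst w)
      - snd (transcript k M A (fst w) (snd w) i)\<bar>} \<in> sets ?P" if i: "i < k" for i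
      by (rule borel_measurable_less[OF borel_measurable_const
            borel_measurable_abs[OF borel_measurable_diff[OF emp_m[OF i] reply_m[OF i]]]])
    have "est = (\<Union>i<k. {w \<in> space ?P. \<alpha> < \<bar>empirical_value n (fst (transcript k M A (fst w) (snd w) i)) (fst w)
      - snd (transcript k M A (fst w) (snd w) i)\<bar>})"
      unfolding est_def by blast
    then show ?thesis
      using est_i by (simp only:) (intro sets.finite_UN finite_lessThan, simp only: lessThan_iff)
  qed
  have "measure ?P est \<le> \<beta>"
  proof -
    have "measure ?P est = (\<integral>S. measure (game_coins M A) {c \<in> space (game_coins M A). (S, c) \<in> est} \<partial>\<mu>)"
      by (rule P.measure_fst[OF est_sets])
    also have "\<dots> \<le> (\<integral>S. \<beta> \<partial>\<mu>)"
    proof (intro integral_mono P.measure_fst[OF est_sets])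
      fix S assume S: "S \<in> space \<mu>"
      then have "{c \<in> space (game_coins M A). (S, c) \<in> est} = {c \<in> space (game_coins M A).
          \<exists>i<k. \<bar>empirical_value n (fst (transcript k M A S c i)) S - snd (transcript k M A S c i)\<bar> > \<alpha>}"
        by (auto simp: est_def space_pair_measure)
      then show "measure (game_coins M A) {c \<in> space (game_coins M A). (S, c) \<in> est} \<le> \<beta>"
        using emp A S by (simp add: empirically_accurate_def space_\<mu>)
    qed simp
    finally show ?thesis by (simp add: \<mu>.prob_space)
  qed
  moreover have "?err \<subseteq> est \<union> gap"
  proof
    fix w assume w: "w \<in> ?err"
    then have wP: "w \<in> space ?P" by auto
    obtain S c where Sc: "w = (S, c)" by (cases w)
    define z where "z = observation k M A S c"
    have z: "z \<in> space (observation_space k)" using answer_space[OF wP] by (simp add: z_def Sc)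
    from w obtain i where i: "i < k" and
      big: "\<bar>query_mean n (fst (transcript k M A S c i)) \<mu> - snd (transcript k M A S c i)\<bar> > \<alpha> + 10 * \<epsilon> + 2 * \<psi>"
      by (auto simp: Sc)
    have qq: "fst (transcript k M A S c i) = q (i, True) z" unfolding z_def by (rule ext) (rule query[OF i])
    have iJ: "(i, b) \<in> J" for b using i by (simp add: J_def)
    have qset: "{y. q (i, True) z y} \<in> sets borel"
      by (rule query_sets[OF J(1) _ iJ z]) (rule q)
    have "query_mean n (q (i, True) z) \<mu> = (\<Sum>m<n. measure (marginal \<mu> m) {y. q (i, True) z y}) / real n"
      by (rule query_mean_eq[OF \<mu> sets qset])
    then have dev: "deviation (q (i, True)) S z = empirical_value n (q (i, True) z) S - query_mean n (q (i, True) z) \<mu>"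
      by (simp add: deviation_def empirical_value_def sum_subtractf diff_divide_distrib)
    have "q (i, False) = (\<lambda>z y. \<not> q (i, True) z y)" by (simp add: q_def fun_eq_iff)
    then have neg: "deviation (q (i, False)) S z = - deviation (q (i, True)) S z"
      using deviation_not[of "q (i, True)", OF qset] by (simp only:)
    show "w \<in> est \<union> gap"
    proof (cases "w \<in> est")
      case False
      have "w \<in> est" if "\<alpha> < \<bar>empirical_value n (fst (transcript k M A S c i)) S - snd (transcript k M A S c i)\<bar>"
        unfolding est_def Sc using that i wP by (auto simp: Sc)
      with False have "\<bar>empirical_value n (q (i, True) z) S - snd (transcript k M A S c i)\<bar> \<le> \<alpha>"
        unfolding qq by linarith
      with big have "\<bar>deviation (q (i, True)) S z\<bar> > 10 * \<epsilon> + 2 * \<psi>" unfolding dev qq by linarith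
      then have "deviation (q (i, True)) S z > 10 * \<epsilon> + \<psi> \<or> deviation (q (i, False)) S z > 10 * \<epsilon> + \<psi>"
        using \<psi> unfolding neg by linarith
      then show ?thesis using iJ wP by (auto simp: gap_def Sc z_def)
    qed simp
  qed
  \<comment> \<open>Monotonicity asks for measurability of the covering event only, so none is
    established for \<open>?err\<close>.\<close>
  ultimately show ?thesis
    using P.finite_measure_mono[of ?err "est \<union> gap"] est_sets gap measure_Un_le[of est ?P gap] by (smt (verit) sets.Un)
qed

theorem theorem1p4:
  fixes \<epsilon> \<delta> \<alpha> \<beta> \<psi> :: real and n k :: nat
    and M :: "('x::metric_space, 'w) mechanism"
  assumes "\<epsilon> > 0" "\<delta> > 0" "\<alpha> \<ge> 0" "\<beta> \<ge> 0" "\<psi> \<ge> 0"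
    and "mechanism_wf n k M"
    and "private_mechanism n k \<epsilon> \<delta> M"
    and "empirically_accurate n k \<alpha> \<beta> M"
    and "real n \<ge> ln (2 * real k * \<epsilon> / \<delta>) / \<epsilon>\<^sup>2"
  shows "statistically_accurate n k (\<alpha> + 10 * \<epsilon> + 2 * \<psi>) (\<beta> + \<delta> / \<epsilon>) (gibbs_dependence n \<psi>) M"
  unfolding statistically_accurate_def
proof (intro allI impI)
  fix \<mu> :: "(nat \<Rightarrow> 'x) measure" and A :: "'x adversary"
  assume \<mu>: "prob_space \<mu>" "sets \<mu> = sets (data_space n)" "gibbs_dependence n \<psi> \<mu>" and A: "adversary_wf k A"
  let ?P = "\<mu> \<Otimes>\<^sub>M game_coins M A"
  show "measure ?P {(S, c) \<in> space ?P. \<exists>i<k. \<alpha> + 10 * \<epsilon> + 2 * \<psi> <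
      \<bar>query_mean n (fst (transcript k M A S c i)) \<mu> - snd (transcript k M A S c i)\<bar>} \<le> \<beta> + \<delta> / \<epsilon>"
    (is "measure _ ?err \<le> _")
  \<comment> \<open>Otherwise the bound is immediate: without rounds the error event is empty, and
    for \<delta> > \<epsilon> the right-hand side is at least 1.\<close>
  proof (cases "k > 0 \<and> \<delta> \<le> \<epsilon>")
    case True
    then show ?thesis using assms \<mu> A by (intro statistical_error_bound) auto
  next
    case False
    interpret \<mu>: prob_space \<mu> by fact
    interpret m: prob_space "mech_coins M" using assms(6) by (simp add: mechanism_wf_def)
    interpret r: prob_space "adv_coins A" using A by (simp add: adversary_wf_def)
    interpret G: pair_prob_space "mech_coins M" "adv_coins A" ..
    interpret P: pair_prob_space \<mu> "game_coins M A" ..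
    show ?thesis
    proof (cases "k = 0")
      case True
      then show ?thesis using assms(1,2,4) by simp
    next
      case False
      with \<open>\<not> (k > 0 \<and> \<delta> \<le> \<epsilon>)\<close> have "1 \<le> \<delta> / \<epsilon>" using assms(1) by simp
      with P.prob_le_1[of ?err] assms(4) show ?thesis by linarith
    qed
  qed
qed

end
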